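(* Let $(M,g)$ be an $n$-dimensional pseudo-Riemannian manifold, $n\ge3$, let $I\subseteq\mathbb R$ be an open connected interval, let $f\colon M\to(0,\infty)$ be smooth with $H^f=0$, and let $\bar M=I_f\times M$ be the standard static space-time with metric $\bar g=-f^2\mathrm dt^2\oplus g$. Then the concircular curvature tensor $\bar{\mathcal C}$ of $(\bar M,\bar g)$ is divergence free if and only if the concircular curvature tensor $\mathcal C$ of $(M,g)$ is divergence free.
   Context: $H^f$ is the Hessian of $f$ on $(M,g)$. With $\mathcal R(X,Y)Z=\nabla_Y\nabla_XZ-\nabla_X\nabla_YZ+\nabla_{[X,Y]}Z$ and $\mathcal R(X,Y,Z,V)=g(\mathcal R(X,Y)Z,V)$, the concircular curvature tensor of an $m$-dimensional pseudo-Riemannian manifold with metric $g$ and scalar curvature $\tau$ is $\mathcal C(X,Y,Z,V)=\mathcal R(X,Y,Z,V)-\frac{\tau}{m(m-1)}[g(X,Z)g(Y,V)-g(Y,Z)g(X,V)]$; it is divergence free if $\nabla^{l}\mathcal C_{ijkl}=0$ (equivalently, by its symmetries, the divergence in any slot vanishes). *)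

theory Defs
  imports "HOL-Analysis.Analysis"
begin

section \<open>Smooth manifolds\<close>

(* On an open set S of a finite-dimensional space, continuity of all directional derivatives
   is the same as continuity of the derivative, so this is the usual class C^k. *)
primrec Ck_on :: "nat \<Rightarrow> 'e::euclidean_space set \<Rightarrow> ('e \<Rightarrow> 'f::real_normed_vector) \<Rightarrow> bool" where
  "Ck_on 0 S F \<longleftrightarrow> continuous_on S F"
| "Ck_on (Suc k) S F \<longleftrightarrow>
     (\<forall>x\<in>S. F differentiable (at x)) \<and>
     (\<forall>v. Ck_on k S (\<lambda>x. frechet_derivative F (at x) v))"

definition smooth_on :: "'e::euclidean_space set \<Rightarrow> ('e \<Rightarrow> 'f::real_normed_vector) \<Rightarrow> bool" where
  "smooth_on S F \<longleftrightarrow> (\<forall>k. Ck_on k S F)"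

(* A topological space with an indexed atlas {(U_k, phi_k)}. The model space 'e is an arbitrary
   Euclidean space, so the dimension of the manifold is DIM('e). *)
record ('a, 'k, 'e) atlas =
  base :: "'a topology"
  charts :: "'k set"
  cdom :: "'k \<Rightarrow> 'a set"
  cmap :: "'k \<Rightarrow> 'a \<Rightarrow> 'e"

definition cimage :: "('a, 'k, 'e) atlas \<Rightarrow> 'k \<Rightarrow> 'e set" where
  "cimage M k = cmap M k ` cdom M k"

definition cinv :: "('a, 'k, 'e) atlas \<Rightarrow> 'k \<Rightarrow> 'e \<Rightarrow> 'a" where
  "cinv M k = inv_into (cdom M k) (cmap M k)"

definition transition :: "('a, 'k, 'e) atlas \<Rightarrow> 'k \<Rightarrow> 'k \<Rightarrow> 'e \<Rightarrow> 'e" where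
  "transition M k l = cmap M l \<circ> cinv M k"

definition smooth_manifold :: "('a, 'k, 'e::euclidean_space) atlas \<Rightarrow> bool" where
  "smooth_manifold M \<longleftrightarrow>
     Hausdorff_space (base M) \<and> second_countable (base M) \<and>
     (\<Union>k\<in>charts M. cdom M k) = topspace (base M) \<and>
     (\<forall>k\<in>charts M. openin (base M) (cdom M k) \<and> open (cimage M k) \<and>
        homeomorphic_map (subtopology (base M) (cdom M k)) (top_of_set (cimage M k)) (cmap M k)) \<and>
     (\<forall>k\<in>charts M. \<forall>l\<in>charts M.
        smooth_on (cmap M k ` (cdom M k \<inter> cdom M l)) (transition M k l))"

definition smooth_function :: "('a, 'k, 'e::euclidean_space) atlas \<Rightarrow> ('a \<Rightarrow> real) \<Rightarrow> bool" where
  "smooth_function M f \<longleftrightarrow> (\<forall>k\<in>charts M. smooth_on (cimage M k) (f \<circ> cinv M k))"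


section \<open>Pseudo-Riemannian metrics\<close>

(* A metric on an open set of coordinates: a bilinear form at every point. A metric on a manifold
   is one such form per chart; the forms of two charts are related by the tensor transformation
   law. *)
type_synonym 'e local_metric = "'e \<Rightarrow> 'e \<Rightarrow> 'e \<Rightarrow> real"

definition pseudo_riemannian_metric ::
  "('a, 'k, 'e::euclidean_space) atlas \<Rightarrow> ('k \<Rightarrow> 'e local_metric) \<Rightarrow> bool" where
  "pseudo_riemannian_metric M g \<longleftrightarrow>
     (\<forall>k\<in>charts M. \<forall>x\<in>cimage M k.
        bilinear (g k x) \<and>
        (\<forall>u v. g k x u v = g k x v u) \<and>
        (\<forall>u. (\<forall>v. g k x u v = 0) \<longrightarrow> u = 0)) \<and>
     (\<forall>k\<in>charts M. \<forall>u v. smooth_on (cimage M k) (\<lambda>x. g k x u v)) \<and>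
     (\<forall>k\<in>charts M. \<forall>l\<in>charts M. \<forall>x\<in>cmap M k ` (cdom M k \<inter> cdom M l). \<forall>u v.
        let D = frechet_derivative (transition M k l) (at x)
        in g k x u v = g l (transition M k l x) (D u) (D v))"

definition pseudo_riemannian_manifold ::
  "('a, 'k, 'e::euclidean_space) atlas \<Rightarrow> ('k \<Rightarrow> 'e local_metric) \<Rightarrow> bool" where
  "pseudo_riemannian_manifold M g \<longleftrightarrow> smooth_manifold M \<and> pseudo_riemannian_metric M g"


section \<open>Connection and curvature in a chart\<close>

(* D_v F (x) *)
abbreviation dirD :: "('e::euclidean_space \<Rightarrow> 'f::real_normed_vector) \<Rightarrow> 'e \<Rightarrow> 'e \<Rightarrow> 'f" where
  "dirD F x v \<equiv> frechet_derivative F (at x) v"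

(* The vector metrically equivalent to a covector. In particular sharp h x (\<lambda>w. w \<bullet> b) has the
   components h^{bc}, c in Basis, of the inverse metric. *)
definition sharp :: "'e::euclidean_space local_metric \<Rightarrow> 'e \<Rightarrow> ('e \<Rightarrow> real) \<Rightarrow> 'e" where
  "sharp h x \<alpha> = (THE v. \<forall>w. h x v w = \<alpha> w)"

(* The Levi-Civita connection: the Koszul formula for the constant vector fields u, v, w. *)
definition christoffel :: "'e::euclidean_space local_metric \<Rightarrow> 'e \<Rightarrow> 'e \<Rightarrow> 'e \<Rightarrow> 'e" where
  "christoffel h x u v = sharp h x (\<lambda>w.
     (dirD (\<lambda>y. h y v w) x u + dirD (\<lambda>y. h y u w) x v - dirD (\<lambda>y. h y u v) x w) / 2)"

definition nabla ::
  "'e::euclidean_space local_metric \<Rightarrow> ('e \<Rightarrow> 'e) \<Rightarrow> ('e \<Rightarrow> 'e) \<Rightarrow> 'e \<Rightarrow> 'e" where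
  "nabla h X Y x = dirD Y x (X x) + christoffel h x (X x) (Y x)"

definition lie_bracket :: "('e::euclidean_space \<Rightarrow> 'e) \<Rightarrow> ('e \<Rightarrow> 'e) \<Rightarrow> 'e \<Rightarrow> 'e" where
  "lie_bracket X Y x = dirD Y x (X x) - dirD X x (Y x)"

definition riemann ::
  "'e::euclidean_space local_metric \<Rightarrow> ('e \<Rightarrow> 'e) \<Rightarrow> ('e \<Rightarrow> 'e) \<Rightarrow> ('e \<Rightarrow> 'e) \<Rightarrow> 'e \<Rightarrow> 'e" where
  "riemann h X Y Z x =
     nabla h Y (nabla h X Z) x - nabla h X (nabla h Y Z) x + nabla h (lie_bracket X Y) Z x"

(* Tensor fields are evaluated on tangent vectors by extending these to constant fields. *)
definition riemann4 :: "'e::euclidean_space local_metric \<Rightarrow> 'e \<Rightarrow> 'e \<Rightarrow> 'e \<Rightarrow> 'e \<Rightarrow> 'e \<Rightarrow> real" where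
  "riemann4 h x u v w z = h x (riemann h (\<lambda>_. u) (\<lambda>_. v) (\<lambda>_. w) x) z"

(* Ric(u, w) is the trace of v \<mapsto> R(u, v)w. With the sign convention of riemann this is the usual
   Ricci tensor, positive on round spheres. *)
definition ricci :: "'e::euclidean_space local_metric \<Rightarrow> 'e \<Rightarrow> 'e \<Rightarrow> 'e \<Rightarrow> real" where
  "ricci h x u w = (\<Sum>b\<in>Basis. riemann h (\<lambda>_. u) (\<lambda>_. b) (\<lambda>_. w) x \<bullet> b)"

definition scalar_curvature :: "'e::euclidean_space local_metric \<Rightarrow> 'e \<Rightarrow> real" where
  "scalar_curvature h x = (\<Sum>b\<in>Basis. ricci h x (sharp h x (\<lambda>w. w \<bullet> b)) b)"

definition concircular ::
  "'e::euclidean_space local_metric \<Rightarrow> 'e \<Rightarrow> 'e \<Rightarrow> 'e \<Rightarrow> 'e \<Rightarrow> 'e \<Rightarrow> real" where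
  "concircular h x u v w z =
     riemann4 h x u v w z
     - scalar_curvature h x / (real DIM('e) * (real DIM('e) - 1))
       * (h x u w * h x v z - h x v w * h x u z)"

(* The covariant derivative of a covariant 4-tensor field T in the direction s. *)
definition nabla4 ::
  "'e::euclidean_space local_metric \<Rightarrow> ('e \<Rightarrow> 'e \<Rightarrow> 'e \<Rightarrow> 'e \<Rightarrow> 'e \<Rightarrow> real) \<Rightarrow>
   'e \<Rightarrow> 'e \<Rightarrow> 'e \<Rightarrow> 'e \<Rightarrow> 'e \<Rightarrow> 'e \<Rightarrow> real" where
  "nabla4 h T x s u v w z =
     dirD (\<lambda>y. T y u v w z) x s
     - T x (christoffel h x s u) v w z - T x u (christoffel h x s v) w z
     - T x u v (christoffel h x s w) z - T x u v w (christoffel h x s z)"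

(* nabla^l T_{ijkl} = h^{lm} nabla_m T_{ijkl} *)
definition divergence4 ::
  "'e::euclidean_space local_metric \<Rightarrow> ('e \<Rightarrow> 'e \<Rightarrow> 'e \<Rightarrow> 'e \<Rightarrow> 'e \<Rightarrow> real) \<Rightarrow>
   'e \<Rightarrow> 'e \<Rightarrow> 'e \<Rightarrow> 'e \<Rightarrow> real" where
  "divergence4 h T x u v w = (\<Sum>b\<in>Basis. nabla4 h T x (sharp h x (\<lambda>y. y \<bullet> b)) u v w b)"

(* Second covariant derivative of F: u(vF) - (nabla_u v)F for constant fields u, v. *)
definition hessian ::
  "'e::euclidean_space local_metric \<Rightarrow> ('e \<Rightarrow> real) \<Rightarrow> 'e \<Rightarrow> 'e \<Rightarrow> 'e \<Rightarrow> real" where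
  "hessian h F x u v = dirD (\<lambda>y. dirD F y v) x u - dirD F x (christoffel h x u v)"


section \<open>Global notions\<close>

definition hessian_zero ::
  "('a, 'k, 'e::euclidean_space) atlas \<Rightarrow> ('k \<Rightarrow> 'e local_metric) \<Rightarrow> ('a \<Rightarrow> real) \<Rightarrow> bool" where
  "hessian_zero M g f \<longleftrightarrow>
     (\<forall>k\<in>charts M. \<forall>x\<in>cimage M k. \<forall>u v. hessian (g k) (f \<circ> cinv M k) x u v = 0)"

definition concircular_divergence_free ::
  "('a, 'k, 'e::euclidean_space) atlas \<Rightarrow> ('k \<Rightarrow> 'e local_metric) \<Rightarrow> bool" where
  "concircular_divergence_free M g \<longleftrightarrow>
     (\<forall>k\<in>charts M. \<forall>x\<in>cimage M k. \<forall>u v w.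
        divergence4 (g k) (concircular (g k)) x u v w = 0)"

(* The product manifold I \<times> M, for I an open subset of the real line with its identity chart. *)
definition interval_times ::
  "real set \<Rightarrow> ('a, 'k, 'e) atlas \<Rightarrow> (real \<times> 'a, 'k, real \<times> 'e) atlas" where
  "interval_times I M =
     \<lparr>base = prod_topology (top_of_set I) (base M),
      charts = charts M,
      cdom = (\<lambda>k. I \<times> cdom M k),
      cmap = (\<lambda>k (t, p). (t, cmap M k p))\<rparr>"

(* -f^2 dt^2 + g on interval_times I M *)
definition static_metric ::
  "('a, 'k, 'e::euclidean_space) atlas \<Rightarrow> ('k \<Rightarrow> 'e local_metric) \<Rightarrow> ('a \<Rightarrow> real) \<Rightarrow>
   'k \<Rightarrow> (real \<times> 'e) local_metric" where
  "static_metric M g f k =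
     (\<lambda>(t, x) (a, u) (b, v). - (f (cinv M k x))\<^sup>2 * a * b + g k x u v)"


section \<open>The standard static space-time is a pseudo-Riemannian manifold\<close>

lemma frechet_derivative_cong_on:
  assumes "open S" "x \<in> S" "\<And>y. y \<in> S \<Longrightarrow> F y = G y" "F differentiable (at x)"
  shows "G differentiable (at x)" "frechet_derivative G (at x) = frechet_derivative F (at x)"
proof -
  have "(F has_derivative frechet_derivative F (at x)) (at x)"
    using assms(4) frechet_derivative_works by blast
  then have "(G has_derivative frechet_derivative F (at x)) (at x)"
    using assms has_derivative_transform_within_open by blast
  then show "G differentiable (at x)" "frechet_derivative G (at x) = frechet_derivative F (at x)"
    using frechet_derivative_at differentiable_def by metis+
qed

lemma Ck_on_cong:
  assumes "open S" "\<And>y. y \<in> S \<Longrightarrow> F y = G y" "Ck_on k S F"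
  shows "Ck_on k S G"
  using assms(2,3)
proof (induction k arbitrary: F G)
  case 0 then show ?case using continuous_on_cong by (metis Ck_on.simps(1))
next
  case (Suc k)
  have *: "G differentiable (at x)" "frechet_derivative G (at x) = frechet_derivative F (at x)"
    if "x \<in> S" for x
    using frechet_derivative_cong_on[OF assms(1) that, of F G] Suc.prems that by auto
  have "Ck_on k S (\<lambda>x. frechet_derivative G (at x) v)" for v
    by (rule Suc.IH[of "\<lambda>x. frechet_derivative F (at x) v"]) (use Suc.prems * in auto)
  with * show ?case by simp
qed

lemma Ck_on_Suc_D: "Ck_on (Suc k) S F \<Longrightarrow> Ck_on k S F"
proof (induction k arbitrary: F)
  case 0
  then show ?case
    using differentiable_imp_continuous_within
    by (auto intro!: continuous_at_imp_continuous_on)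
next
  case (Suc k) then show ?case by (metis Ck_on.simps(2))
qed

lemma Ck_on_const: "Ck_on k S (\<lambda>_. c)"
  by (induction k arbitrary: c) (auto simp: frechet_derivative_const)

lemma Ck_on_SucI:
  assumes "open S" "\<And>x. x \<in> S \<Longrightarrow> (F has_derivative D x) (at x)"
    "\<And>v. Ck_on k S (\<lambda>x. D x v)"
  shows "Ck_on (Suc k) S F"
proof -
  have *: "D x = frechet_derivative F (at x)" if "x \<in> S" for x
    using assms(2)[OF that] frechet_derivative_at by blast
  have "Ck_on k S (\<lambda>x. frechet_derivative F (at x) v)" for v
    by (rule Ck_on_cong[OF assms(1) _ assms(3)[of v]]) (simp add: *)
  then show ?thesis using assms(2) differentiable_def by fastforce
qed

lemma Ck_on_add:
  assumes "open S" shows "Ck_on k S F \<Longrightarrow> Ck_on k S G \<Longrightarrow> Ck_on k S (\<lambda>x. F x + G x)"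
proof (induction k arbitrary: F G)
  case 0 then show ?case by (simp add: continuous_on_add)
next
  case (Suc k)
  show ?case
    by (rule Ck_on_SucI[OF assms, where D = "\<lambda>x v. frechet_derivative F (at x) v + frechet_derivative G (at x) v"])
       (use Suc in \<open>auto intro!: has_derivative_add simp: frechet_derivative_works\<close>)
qed

lemma Ck_on_mult:
  fixes F G :: "'e::euclidean_space \<Rightarrow> real"
  assumes "open S" shows "Ck_on k S F \<Longrightarrow> Ck_on k S G \<Longrightarrow> Ck_on k S (\<lambda>x. F x * G x)"
proof (induction k arbitrary: F G)
  case 0 then show ?case by (simp add: continuous_on_mult)
next
  case (Suc k)
  show ?case
    by (rule Ck_on_SucI[OF assms, where D = "\<lambda>x v. F x * frechet_derivative G (at x) v + frechet_derivative F (at x) v * G x"])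
       (use Suc.prems Ck_on_Suc_D[OF Suc.prems(1)] Ck_on_Suc_D[OF Suc.prems(2)]
        in \<open>auto intro!: has_derivative_mult Ck_on_add assms Suc.IH simp: frechet_derivative_works[symmetric]\<close>)
qed

lemma Ck_on_linear_o:
  fixes F :: "'d::euclidean_space \<Rightarrow> 'e::real_normed_vector"
  assumes "open S" "bounded_linear L" shows "Ck_on k S F \<Longrightarrow> Ck_on k S (\<lambda>x. L (F x))"
proof (induction k arbitrary: F)
  case 0 then show ?case
    using assms(2) by (simp add: bounded_linear.continuous_on)
next
  case (Suc k)
  show ?case
    by (rule Ck_on_SucI[OF assms(1), where D = "\<lambda>x v. L (frechet_derivative F (at x) v)"])
       (use Suc in \<open>auto intro!: bounded_linear.has_derivative[OF assms(2)] simp: frechet_derivative_works\<close>)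
qed

lemma Ck_on_linear:
  assumes "open S" "bounded_linear L" shows "Ck_on k S L"
proof (cases k)
  case 0 then show ?thesis using assms(2) by (simp add: linear_continuous_on)
next
  case (Suc j)
  show ?thesis unfolding Suc
    by (rule Ck_on_SucI[OF assms(1), where D = "\<lambda>_. L"])
       (use assms(2) bounded_linear_imp_has_derivative Ck_on_const in auto)
qed

lemma Ck_on_snd:
  fixes F :: "'e::euclidean_space \<Rightarrow> 'f::real_normed_vector"
  assumes "open T" "open S" shows "Ck_on k S F \<Longrightarrow> Ck_on k (T \<times> S) (\<lambda>p::'d::euclidean_space \<times> 'e. F (snd p))"
proof (induction k arbitrary: F)
  case 0 
  have "continuous_on (T \<times> S) (F \<circ> snd)"
    by (rule continuous_on_compose) (use 0 in \<open>auto intro: continuous_on_snd continuous_on_subset continuous_on_id\<close>)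
  then show ?case by (simp add: o_def)
next
  case (Suc k)
  show ?case
  proof (rule Ck_on_SucI[OF open_Times[OF assms], where D = "\<lambda>p v. frechet_derivative F (at (snd p)) (snd v)"])
    fix x :: "'d \<times> 'e" assume "x \<in> T \<times> S"
    then have "(F has_derivative frechet_derivative F (at (snd x))) (at (snd x))"
      using Suc.prems by (auto simp: frechet_derivative_works)
    from has_derivative_compose[OF has_derivative_snd[OF has_derivative_ident] this, of UNIV]
    show "((\<lambda>p. F (snd p)) has_derivative (\<lambda>v. frechet_derivative F (at (snd x)) (snd v))) (at x)"
      by simp
  qed (use Suc in auto)
qed

lemma second_countable_euclidean: "second_countable (euclidean :: 'e::second_countable_topology topology)"
proof -
  obtain B :: "'e set set" where "countable B" "topological_basis B"
    using ex_countable_basis by blast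
  then show ?thesis
    unfolding second_countable_def
    by (intro exI[of _ B]) (auto simp: topological_basis_open elim!: topological_basisE)
qed

lemma second_countable_prod:
  assumes "second_countable X" "second_countable Y"
  shows "second_countable (prod_topology X Y)"
proof -
  obtain A where A: "countable A" "\<And>V. V \<in> A \<Longrightarrow> openin X V"
    "\<And>U x. openin X U \<Longrightarrow> x \<in> U \<Longrightarrow> \<exists>V\<in>A. x \<in> V \<and> V \<subseteq> U"
    using assms(1) unfolding second_countable_def by metis
  obtain B where B: "countable B" "\<And>V. V \<in> B \<Longrightarrow> openin Y V"
    "\<And>U x. openin Y U \<Longrightarrow> x \<in> U \<Longrightarrow> \<exists>V\<in>B. x \<in> V \<and> V \<subseteq> U"
    using assms(2) unfolding second_countable_def by metis
  have "\<exists>V\<in>(\<lambda>(a, b). a \<times> b) ` (A \<times> B). z \<in> V \<and> V \<subseteq> W"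
    if W: "openin (prod_topology X Y) W" "z \<in> W" for W z
  proof -
    obtain x y where z: "z = (x, y)" by (cases z)
    obtain U V where UV: "openin X U" "openin Y V" "x \<in> U" "y \<in> V" "U \<times> V \<subseteq> W"
      using W unfolding openin_prod_topology_alt z by metis
    obtain a b where "a \<in> A" "x \<in> a" "a \<subseteq> U" "b \<in> B" "y \<in> b" "b \<subseteq> V"
      using A(3)[OF UV(1,3)] B(3)[OF UV(2,4)] by blast
    then show ?thesis
      using UV(5) z by (intro bexI[of _ "a \<times> b"]) blast+
  qed
  then show ?thesis
    unfolding second_countable_def using A(1,2) B(1,2)
    by (intro exI[of _ "(\<lambda>(a, b). a \<times> b) ` (A \<times> B)"]) (auto simp: openin_prod_Times_iff)
qed

lemma cimage_interval_times: "cimage (interval_times I M) k = I \<times> cimage M k"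
  by (auto simp: cimage_def interval_times_def image_iff)

lemma cinv_interval_times:
  assumes "inj_on (cmap M k) (cdom M k)" "t \<in> I" "x \<in> cimage M k"
  shows "cinv (interval_times I M) k (t, x) = (t, cinv M k x)"
  unfolding cinv_def interval_times_def atlas.simps
proof (rule inv_into_f_eq)
  show "inj_on (\<lambda>(t, p). (t, cmap M k p)) (I \<times> cdom M k)"
    using assms(1) by (auto simp: inj_on_def)
qed (use assms in \<open>auto simp: cimage_def inv_into_into f_inv_into_f\<close>)

lemma pseudo_riemannian_static:
  fixes M :: "('a, 'k, 'e::euclidean_space) atlas"
  assumes M: "pseudo_riemannian_manifold M g" and I: "open I"
    and f: "smooth_function M f" and pos: "\<forall>p\<in>topspace (base M). f p > 0"
  shows "pseudo_riemannian_manifold (interval_times I M) (static_metric M g f)"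
proof -
  let ?N = "interval_times I M" and ?h = "static_metric M g f"
  have sm: "smooth_manifold M" and gm: "pseudo_riemannian_metric M g"
    using M by (auto simp: pseudo_riemannian_manifold_def)
  have hm: "homeomorphic_map (subtopology (base M) (cdom M k)) (top_of_set (cimage M k)) (cmap M k)"
    and od: "openin (base M) (cdom M k)" and oi: "open (cimage M k)" if "k \<in> charts M" for k
    using sm that by (auto simp: smooth_manifold_def)
  have inj: "inj_on (cmap M k) (cdom M k)" if "k \<in> charts M" for k
    using hm[OF that] od[OF that] unfolding homeomorphic_map_def
    by (metis openin_subset topspace_subtopology_subset)
  have oV: "open (cmap M k ` (cdom M k \<inter> cdom M l))" if "k \<in> charts M" "l \<in> charts M" for k l
  proof -
    have "openin (subtopology (base M) (cdom M k)) (cdom M k \<inter> cdom M l)"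
      using od that by (metis inf_commute openin_subtopology_Int)
    then have "openin (top_of_set (cimage M k)) (cmap M k ` (cdom M k \<inter> cdom M l))"
      using hm[OF that(1)] homeomorphic_imp_open_map open_map_def by blast
    then show ?thesis using oi[OF that(1)] openin_open_eq by blast
  qed
  have ov: "cmap ?N k ` (cdom ?N k \<inter> cdom ?N l) = I \<times> cmap M k ` (cdom M k \<inter> cdom M l)" for k l
    by (auto simp: interval_times_def image_iff)
  have tr: "transition ?N k l (t, x) = (t, transition M k l x)"
    if "k \<in> charts M" "t \<in> I" "x \<in> cimage M k" for k l t x
    unfolding transition_def comp_def cinv_interval_times[OF inj[OF that(1)] that(2,3)]
    by (simp add: interval_times_def)
  have sub: "x \<in> cmap M k ` (cdom M k \<inter> cdom M l) \<Longrightarrow> x \<in> cimage M k" for x k l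
    by (auto simp: cimage_def)
  have smt: "smooth_on (cmap M k ` (cdom M k \<inter> cdom M l)) (transition M k l)"
    if "k \<in> charts M" "l \<in> charts M" for k l
    using sm that by (auto simp: smooth_manifold_def)
  have cinv_trans: "cinv M l (transition M k l x) = cinv M k x"
    if t: "k \<in> charts M" "l \<in> charts M" "x \<in> cmap M k ` (cdom M k \<inter> cdom M l)" for k l x
  proof -
    obtain p where p: "p \<in> cdom M k" "p \<in> cdom M l" "x = cmap M k p" using t(3) by blast
    then have "cinv M k x = p" using inj[OF t(1)] by (simp add: cinv_def)
    then show ?thesis using p inj[OF t(2)] by (simp add: transition_def cinv_def)
  qed
  have cin: "cinv M k x \<in> topspace (base M)" if "k \<in> charts M" "x \<in> cimage M k" for k x
    using that od openin_subset unfolding cinv_def cimage_def by (metis inv_into_into subsetD)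

  have "smooth_manifold ?N"
    unfolding smooth_manifold_def
  proof (intro conjI ballI)
    show "Hausdorff_space (base ?N)"
      using sm by (auto simp: smooth_manifold_def interval_times_def Hausdorff_space_prod_topology
          intro!: Hausdorff_space_subtopology)
    show "second_countable (base ?N)"
      using sm by (auto simp: smooth_manifold_def interval_times_def
          intro!: second_countable_prod second_countable_subtopology second_countable_euclidean)
    show "(\<Union>k\<in>charts ?N. cdom ?N k) = topspace (base ?N)"
      using sm by (auto simp: smooth_manifold_def interval_times_def)
  next
    fix k assume "k \<in> charts ?N"
    then have k: "k \<in> charts M" by (simp add: interval_times_def)
    show "openin (base ?N) (cdom ?N k)"
      using od[OF k] by (auto simp: interval_times_def openin_prod_Times_iff)
    show "open (cimage ?N k)"
      using oi[OF k] I by (auto simp: cimage_interval_times open_Times)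
    obtain r where r: "homeomorphic_maps (subtopology (base M) (cdom M k)) (top_of_set (cimage M k)) (cmap M k) r"
      using hm[OF k] unfolding homeomorphic_map_maps by blast
    have "homeomorphic_maps (prod_topology (top_of_set I) (subtopology (base M) (cdom M k)))
        (prod_topology (top_of_set I) (top_of_set (cimage M k)))
        (\<lambda>(x, y). (id x, cmap M k y)) (\<lambda>(x, y). (id x, r y))"
      unfolding homeomorphic_maps_prod
      by (intro disjI2 conjI r) (simp add: homeomorphic_maps_def)
    then have "homeomorphic_map (prod_topology (top_of_set I) (subtopology (base M) (cdom M k)))
        (prod_topology (top_of_set I) (top_of_set (cimage M k))) (\<lambda>(x, y). (x, cmap M k y))"
      unfolding homeomorphic_map_maps id_def by blast
    moreover have "prod_topology (top_of_set I) (subtopology (base M) (cdom M k))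
        = subtopology (base ?N) (cdom ?N k)"
      by (simp add: interval_times_def subtopology_Times[symmetric] prod_topology_subtopology
          subtopology_subtopology Times_Int_Times)
    moreover have "prod_topology (top_of_set I) (top_of_set (cimage M k)) = top_of_set (I \<times> cimage M k)"
      by simp
    ultimately show "homeomorphic_map (subtopology (base ?N) (cdom ?N k)) (top_of_set (cimage ?N k)) (cmap ?N k)"
      unfolding cimage_interval_times by (simp add: interval_times_def)
  next
    fix k l assume "k \<in> charts ?N" "l \<in> charts ?N"
    then have kl: "k \<in> charts M" "l \<in> charts M" by (auto simp: interval_times_def)
    let ?V = "cmap M k ` (cdom M k \<inter> cdom M l)"
    show "smooth_on (cmap ?N k ` (cdom ?N k \<inter> cdom ?N l)) (transition ?N k l)"
      unfolding ov smooth_on_def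
    proof
      fix j
      have o: "open (I \<times> ?V)" using I oV[OF kl] by (simp add: open_Times)
      have "Ck_on j ?V (transition M k l)" using smt[OF kl] by (simp add: smooth_on_def)
      then have "Ck_on j (I \<times> ?V) (\<lambda>p. (0::real, transition M k l (snd p)))"
        by (intro Ck_on_linear_o[OF o, of "\<lambda>x. (0, x)"] Ck_on_snd I oV[OF kl])
           (auto intro!: bounded_linear_Pair bounded_linear_zero bounded_linear_ident)
      moreover have "Ck_on j (I \<times> ?V) (\<lambda>p::real \<times> 'e. (fst p, 0::'e))"
        by (intro Ck_on_linear o bounded_linear_Pair bounded_linear_fst bounded_linear_zero)
      ultimately have "Ck_on j (I \<times> ?V) (\<lambda>p. (fst p, 0) + (0, transition M k l (snd p)))"
        by (intro Ck_on_add o)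
      then show "Ck_on j (I \<times> ?V) (transition ?N k l)"
        by (rule Ck_on_cong[OF o, rotated]) (use tr[OF kl(1)] sub in fastforce)
    qed
  qed
  moreover have "pseudo_riemannian_metric ?N ?h"
    unfolding pseudo_riemannian_metric_def
  proof (intro conjI ballI allI impI)
    fix k z assume "k \<in> charts ?N" and z: "z \<in> cimage ?N k"
    then have k: "k \<in> charts M" by (simp add: interval_times_def)
    obtain t x where z: "z = (t, x)" "t \<in> I" "x \<in> cimage M k"
      using z by (auto simp: cimage_interval_times)
    have b: "bilinear (g k x)" and s: "\<And>u v. g k x u v = g k x v u"
      and n: "\<And>u. (\<And>v. g k x u v = 0) \<Longrightarrow> u = 0"
      using gm k z by (auto simp: pseudo_riemannian_metric_def)
    show "bilinear (?h k z)"
      using b by (auto simp: bilinear_def static_metric_def z linear_iff algebra_simps)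
    show "?h k z u v = ?h k z v u" for u v
      using s by (cases u, cases v) (auto simp: static_metric_def z)
    show "u = 0" if *: "\<forall>v. ?h k z u v = 0" for u
    proof -
      obtain a u' where u: "u = (a, u')" by (cases u)
      have "g k x u' v = 0" for v
        using *[rule_format, of "(0, v)"] by (simp add: static_metric_def z u)
      then have "u' = 0" using n by blast
      moreover have "a = 0"
        using *[rule_format, of "(1, 0)"] pos cin[OF k z(3)] bilinear_rzero[OF b]
        by (auto simp: static_metric_def z u)
      ultimately show ?thesis by (simp add: u zero_prod_def)
    qed
  next
    fix k and u v :: "real \<times> 'e" assume "k \<in> charts ?N"
    then have k: "k \<in> charts M" by (simp add: interval_times_def)
    obtain a u' b v' where uv: "u = (a, u')" "v = (b, v')" by (cases u, cases v)
    show "smooth_on (cimage ?N k) (\<lambda>x. ?h k x u v)"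
      unfolding smooth_on_def cimage_interval_times
    proof
      fix j
      have "Ck_on j (cimage M k) (\<lambda>x. f (cinv M k x))"
        using f k by (simp add: smooth_function_def smooth_on_def o_def)
      moreover have "Ck_on j (cimage M k) (\<lambda>x. g k x u' v')"
        using gm k by (simp add: pseudo_riemannian_metric_def smooth_on_def)
      ultimately have "Ck_on j (cimage M k)
          (\<lambda>x. (- (a * b)) * (f (cinv M k x) * f (cinv M k x)) + g k x u' v')"
        by (intro Ck_on_add Ck_on_mult Ck_on_const oi[OF k])
      from Ck_on_snd[OF I oi[OF k] this]
      show "Ck_on j (I \<times> cimage M k) (\<lambda>x. ?h k x u v)"
        by (rule Ck_on_cong[OF open_Times[OF I oi[OF k]], rotated])
           (auto simp: static_metric_def uv power2_eq_square)
    qed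
  next
    fix k l z and u v :: "real \<times> 'e" assume "k \<in> charts ?N" "l \<in> charts ?N"
      and z: "z \<in> cmap ?N k ` (cdom ?N k \<inter> cdom ?N l)"
    then have kl: "k \<in> charts M" "l \<in> charts M" by (auto simp: interval_times_def)
    let ?V = "cmap M k ` (cdom M k \<inter> cdom M l)"
    obtain t x where z: "z = (t, x)" "t \<in> I" "x \<in> ?V" using z unfolding ov by auto
    have o: "open (I \<times> ?V)" using I oV[OF kl] by (simp add: open_Times)
    let ?D = "frechet_derivative (transition M k l) (at x)"
    have "Ck_on (Suc 0) ?V (transition M k l)" using smt[OF kl] smooth_on_def by blast
    then have d: "(transition M k l has_derivative ?D) (at (snd z))"
      using z by (auto simp: frechet_derivative_works)
    have "((\<lambda>p. (fst p, transition M k l (snd p))) has_derivative (\<lambda>v. (fst v, ?D (snd v)))) (at z)"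
      using has_derivative_Pair[OF has_derivative_fst[OF has_derivative_ident]
            has_derivative_compose[OF has_derivative_snd[OF has_derivative_ident] d]] by simp
    then have "(transition ?N k l has_derivative (\<lambda>v. (fst v, ?D (snd v)))) (at z)"
    proof (rule has_derivative_transform_within_open[OF _ o])
      show "z \<in> I \<times> ?V" using z by simp
      show "(fst p, transition M k l (snd p)) = transition ?N k l p" if "p \<in> I \<times> ?V" for p
        using that tr[OF kl(1) _ sub[of "snd p"], of "fst p" l l] by (cases p) auto
    qed
    then have D: "frechet_derivative (transition ?N k l) (at z) = (\<lambda>v. (fst v, ?D (snd v)))"
      using frechet_derivative_at by metis
    have "g k x (snd u) (snd v) = g l (transition M k l x) (?D (snd u)) (?D (snd v))"
      using gm kl z(3) unfolding pseudo_riemannian_metric_def Let_def by blast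
    then show "let D = frechet_derivative (transition ?N k l) (at z)
        in ?h k z u v = ?h l (transition ?N k l z) (D u) (D v)"
      unfolding Let_def D
      using z tr[OF kl(1) z(2) sub[OF z(3)]] cinv_trans[OF kl z(3)]
      by (cases u, cases v) (auto simp: static_metric_def)
  qed
  ultimately show ?thesis by (simp add: pseudo_riemannian_manifold_def)
qed

end

(* Everything is local, so fix a chart. Since Hess f = 0, the gradient of f is parallel, and the
   curvature of -f^2 dt^2 + g is the pull-back of the curvature of g: all components involving dt
   vanish and the scalar curvature tau is unchanged. The divergence of the curvature tensor is
   unchanged too; the only extra term is R(u, v, w, grad f) / f = 0. In dimension m the divergence of
   the concircular tensor differs from that of R by (g(u,w) dtau(v) - g(v,w) dtau(u)) / (m (m - 1)).
   If it vanishes on the product, evaluating it on (d/dt, v, d/dt) gives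
   f^2 dtau(v) = 0. If it vanishes
   on M, contracting it with the metric and using the contracted second Bianchi identity gives
   dtau / 2 = dtau / n, so dtau = 0 since n >= 3. In both cases what is left is div R = 0. *)

theory Submission
  imports Defs
begin

section \<open>Directional derivatives of smooth functions\<close>

text \<open>The constants \<open>n (n - 1)\<close> and \<open>(n + 1) n\<close> in the two
  concircular tensors differ, so the two divergences do not match term by term; this is why both
  directions pass through dtau = 0. The equivalence is proved point by point, at
  \<open>(t, x)\<close> on the product against \<open>x\<close> on \<open>M\<close>. The curvature
  is a pull-back because every curvature component of -f^2 dt^2 + g that involves dt is a multiple
  of the Hessian of f. The signature is arbitrary, so orthonormal frames are avoided: each trace
  pairs \<open>Basis\<close> with its metric dual, which varies with the point. The smoothness of
  this dual basis has to be established before the connection can be differentiated. The geometry is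
  developed for a metric on an open set of any Euclidean space and is then read off both for
  \<open>U\<close> and for \<open>J \<times> U\<close>, so that the Bianchi identities and the
  divergence formula are proved once.\<close>

lemma has_dirD: "F differentiable (at x) \<Longrightarrow> (F has_derivative dirD F x) (at x)"
  by (simp add: frechet_derivative_works)

lemma dirD_eqI: "(F has_derivative D) (at x) \<Longrightarrow> dirD F x v = D v"
  by (metis frechet_derivative_at)

text \<open>\<open>frechet_derivative\<close> is a choice among the derivatives at \<open>x\<close>,
  and these are the same for functions that agree near \<open>x\<close>; so the equation holds even
  where no derivative exists.\<close>

lemma dirD_cong:
  assumes "open S" "x \<in> S" "\<And>y. y \<in> S \<Longrightarrow> F y = G y"
  shows "dirD F x v = dirD G x v"
proof -
  have "(F has_derivative D) (at x) \<longleftrightarrow> (G has_derivative D) (at x)" for D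
    using assms has_derivative_transform_within_open by metis
  then show ?thesis by (simp add: frechet_derivative_def)
qed

lemma dirD_const [simp]: "dirD (\<lambda>_. c) x v = 0"
  by (simp add: frechet_derivative_const)

lemma linear_dirD: "F differentiable (at x) \<Longrightarrow> linear (dirD F x)"
  by (rule linear_frechet_derivative)

lemma dirD_add:
  "F differentiable (at x) \<Longrightarrow> G differentiable (at x) \<Longrightarrow>
   dirD (\<lambda>y. F y + G y) x v = dirD F x v + dirD G x v"
  by (rule dirD_eqI) (intro has_derivative_add has_dirD)

lemma dirD_diff:
  "F differentiable (at x) \<Longrightarrow> G differentiable (at x) \<Longrightarrow>
   dirD (\<lambda>y. F y - G y) x v = dirD F x v - dirD G x v"
  by (rule dirD_eqI) (intro has_derivative_diff has_dirD)

lemma dirD_sum: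
  "(\<And>b. b \<in> B \<Longrightarrow> F b differentiable (at x)) \<Longrightarrow>
   dirD (\<lambda>y. \<Sum>b\<in>B. F b y) x v = (\<Sum>b\<in>B. dirD (F b) x v)"
  by (rule dirD_eqI) (intro has_derivative_sum has_dirD)

lemma dirD_mult:
  fixes F G :: "'e::euclidean_space \<Rightarrow> real"
  shows "F differentiable (at x) \<Longrightarrow> G differentiable (at x) \<Longrightarrow>
   dirD (\<lambda>y. F y * G y) x v = F x * dirD G x v + dirD F x v * G x"
  by (rule dirD_eqI) (intro has_derivative_mult has_dirD)

lemma dirD_scaleR:
  fixes F :: "'e::euclidean_space \<Rightarrow> real"
  shows "F differentiable (at x) \<Longrightarrow> G differentiable (at x) \<Longrightarrow>
   dirD (\<lambda>y. F y *\<^sub>R G y) x v = F x *\<^sub>R dirD G x v + dirD F x v *\<^sub>R G x"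
  by (rule dirD_eqI) (intro has_derivative_scaleR has_dirD)

lemma dirD_linear_o:
  "bounded_linear L \<Longrightarrow> F differentiable (at x) \<Longrightarrow> dirD (\<lambda>y. L (F y)) x v = L (dirD F x v)"
  by (rule dirD_eqI) (erule bounded_linear.has_derivative, erule has_dirD)

lemma smooth_on_differentiable: "smooth_on S F \<Longrightarrow> x \<in> S \<Longrightarrow> F differentiable (at x)"
  unfolding smooth_on_def by (metis Ck_on.simps(2))

lemma smooth_on_continuous: "smooth_on S F \<Longrightarrow> continuous_on S F"
  unfolding smooth_on_def by (metis Ck_on.simps(1))

lemma smooth_on_dirD: "smooth_on S F \<Longrightarrow> smooth_on S (\<lambda>x. dirD F x v)"
  unfolding smooth_on_def by (metis Ck_on.simps(2))

lemma smooth_on_cong: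
  "open S \<Longrightarrow> (\<And>y. y \<in> S \<Longrightarrow> F y = G y) \<Longrightarrow> smooth_on S F \<Longrightarrow> smooth_on S G"
  unfolding smooth_on_def by (metis Ck_on_cong)

lemma smooth_on_const: "smooth_on S (\<lambda>_. c)"
  unfolding smooth_on_def by (simp add: Ck_on_const)

lemma smooth_on_add:
  "open S \<Longrightarrow> smooth_on S F \<Longrightarrow> smooth_on S G \<Longrightarrow> smooth_on S (\<lambda>x. F x + G x)"
  unfolding smooth_on_def by (simp add: Ck_on_add)

lemma smooth_on_mult:
  fixes F G :: "'e::euclidean_space \<Rightarrow> real"
  shows "open S \<Longrightarrow> smooth_on S F \<Longrightarrow> smooth_on S G \<Longrightarrow> smooth_on S (\<lambda>x. F x * G x)"
  unfolding smooth_on_def by (simp add: Ck_on_mult)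

lemma smooth_on_linear_o:
  "open S \<Longrightarrow> bounded_linear L \<Longrightarrow> smooth_on S F \<Longrightarrow> smooth_on S (\<lambda>x. L (F x))"
  unfolding smooth_on_def by (simp add: Ck_on_linear_o)

lemma smooth_on_minus: "open S \<Longrightarrow> smooth_on S F \<Longrightarrow> smooth_on S (\<lambda>x. - F x)"
  by (rule smooth_on_linear_o[where L = uminus]) (auto simp: bounded_linear_minus bounded_linear_ident)

lemma smooth_on_diff:
  "open S \<Longrightarrow> smooth_on S F \<Longrightarrow> smooth_on S G \<Longrightarrow> smooth_on S (\<lambda>x. F x - G x)"
  using smooth_on_add[of S F "\<lambda>x. - G x"] smooth_on_minus by force

lemma Ck_on_sum:
  "open S \<Longrightarrow> (\<And>b. b \<in> B \<Longrightarrow> Ck_on k S (F b)) \<Longrightarrow> Ck_on k S (\<lambda>x. \<Sum>b\<in>B. F b x)"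
  by (induction B rule: infinite_finite_induct) (auto intro: Ck_on_add Ck_on_const)

lemma smooth_on_sum:
  "open S \<Longrightarrow> (\<And>b. b \<in> B \<Longrightarrow> smooth_on S (F b)) \<Longrightarrow> smooth_on S (\<lambda>x. \<Sum>b\<in>B. F b x)"
  unfolding smooth_on_def by (simp add: Ck_on_sum)

lemma smooth_on_inner: "open S \<Longrightarrow> smooth_on S F \<Longrightarrow> smooth_on S (\<lambda>x. F x \<bullet> b)"
  by (rule smooth_on_linear_o[where L = "\<lambda>x. x \<bullet> b"]) (auto simp: bounded_linear_inner_left)

lemma Ck_on_scaleR:
  fixes F :: "'e::euclidean_space \<Rightarrow> real"
  assumes "open S"
  shows "Ck_on k S F \<Longrightarrow> Ck_on k S G \<Longrightarrow> Ck_on k S (\<lambda>x. F x *\<^sub>R G x)"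
proof (induction k arbitrary: F G)
  case 0 then show ?case by (simp add: continuous_on_scaleR)
next
  case (Suc k)
  show ?case
    by (rule Ck_on_SucI[OF assms, where D = "\<lambda>x v. F x *\<^sub>R frechet_derivative G (at x) v + frechet_derivative F (at x) v *\<^sub>R G x"])
       (use Suc.prems Ck_on_Suc_D[OF Suc.prems(1)] Ck_on_Suc_D[OF Suc.prems(2)]
        in \<open>auto intro!: has_derivative_scaleR Ck_on_add assms Suc.IH simp: frechet_derivative_works[symmetric]\<close>)
qed

lemma smooth_on_scaleR:
  fixes F :: "'e::euclidean_space \<Rightarrow> real"
  shows "open S \<Longrightarrow> smooth_on S F \<Longrightarrow> smooth_on S G \<Longrightarrow> smooth_on S (\<lambda>x. F x *\<^sub>R G x)"
  unfolding smooth_on_def by (simp add: Ck_on_scaleR)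

section \<open>Point-dependent linear maps applied to fields\<close>

lemma linear_Basis_expand:
  fixes L :: "'d::euclidean_space \<Rightarrow> 'f::real_vector"
  assumes "linear L" shows "L u = (\<Sum>b\<in>Basis. (u \<bullet> b) *\<^sub>R L b)"
  by (subst euclidean_representation[of u, symmetric]) (simp add: linear_sum[OF assms] linear_scale[OF assms])

lemma smooth_on_linear_field:
  fixes L :: "'e::euclidean_space \<Rightarrow> 'd::euclidean_space \<Rightarrow> 'f::real_normed_vector"
  assumes S: "open S" and L: "\<And>y. y \<in> S \<Longrightarrow> linear (L y)" "\<And>u. smooth_on S (\<lambda>y. L y u)"
    and Y: "smooth_on S Y"
  shows "smooth_on S (\<lambda>y. L y (Y y))"
proof (rule smooth_on_cong[OF S])
  show "(\<Sum>b\<in>Basis. (Y y \<bullet> b) *\<^sub>R L y b) = L y (Y y)" if "y \<in> S" for y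
    using linear_Basis_expand[OF L(1)[OF that]] by metis
qed (intro smooth_on_sum smooth_on_scaleR smooth_on_inner S L Y)

text \<open>A Leibniz rule: the first summand differentiates the map with its argument frozen at
  \<open>Y x\<close>. The coordinate formula is used for \<open>Y\<close> and for the constant field
  with value \<open>Y x\<close>; their sums over \<open>Basis\<close> coincide.\<close>

lemma dirD_linear_field:
  fixes L :: "'e::euclidean_space \<Rightarrow> 'd::euclidean_space \<Rightarrow> 'f::real_normed_vector"
  assumes S: "open S" "x \<in> S" and L: "\<And>y. y \<in> S \<Longrightarrow> linear (L y)" "\<And>u. smooth_on S (\<lambda>y. L y u)"
    and Y: "smooth_on S Y"
  shows "dirD (\<lambda>y. L y (Y y)) x v = dirD (\<lambda>y. L y (Y x)) x v + L x (dirD Y x v)"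
proof -
  have *: "dirD (\<lambda>y. L y (Z y)) x v
      = (\<Sum>b\<in>Basis. (Z x \<bullet> b) *\<^sub>R dirD (\<lambda>y. L y b) x v) + L x (dirD Z x v)"
    if Z: "smooth_on S Z" for Z :: "'e \<Rightarrow> 'd"
  proof -
    have d: "(\<lambda>y. L y b) differentiable (at x)" "Z differentiable (at x)"
      "(\<lambda>y. Z y \<bullet> b) differentiable (at x)" for b
      using smooth_on_differentiable S L(2) Z smooth_on_inner[OF S(1) Z] by blast+
    have "dirD (\<lambda>y. L y (Z y)) x v = dirD (\<lambda>y. \<Sum>b\<in>Basis. (Z y \<bullet> b) *\<^sub>R L y b) x v"
      by (rule dirD_cong[OF S]) (use linear_Basis_expand L(1) in metis)
    also have "\<dots> = (\<Sum>b\<in>Basis. (Z x \<bullet> b) *\<^sub>R dirD (\<lambda>y. L y b) x v + (dirD Z x v \<bullet> b) *\<^sub>R L x b)"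
      by (simp add: dirD_sum dirD_scaleR d differentiable_scaleR dirD_linear_o[OF bounded_linear_inner_left])
    also have "\<dots> = (\<Sum>b\<in>Basis. (Z x \<bullet> b) *\<^sub>R dirD (\<lambda>y. L y b) x v) + L x (dirD Z x v)"
      by (simp add: sum.distrib linear_Basis_expand[OF L(1)[OF S(2)], of "dirD Z x v"])
    finally show ?thesis .
  qed
  show ?thesis
    using *[OF Y] *[OF smooth_on_const[of S "Y x"]] linear_0[OF L(1)[OF S(2)]] by simp
qed

lemma linear_dirD_param:
  fixes L :: "'e::euclidean_space \<Rightarrow> 'd::euclidean_space \<Rightarrow> 'f::real_normed_vector"
  assumes S: "open S" "x \<in> S" and L: "\<And>y. y \<in> S \<Longrightarrow> linear (L y)" "\<And>u. smooth_on S (\<lambda>y. L y u)"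
  shows "linear (\<lambda>u. dirD (\<lambda>y. L y u) x v)"
proof (rule linearI)
  have d: "(\<lambda>y. L y b) differentiable (at x)" for b
    using smooth_on_differentiable S L(2) by blast
  show "dirD (\<lambda>y. L y (a + b)) x v = dirD (\<lambda>y. L y a) x v + dirD (\<lambda>y. L y b) x v" for a b
    by (subst dirD_add[symmetric]) (auto intro!: d dirD_cong[OF S] simp: linear_add L)
  show "dirD (\<lambda>y. L y (c *\<^sub>R a)) x v = c *\<^sub>R dirD (\<lambda>y. L y a) x v" for c a
    by (subst dirD_linear_o[OF bounded_linear_scaleR_right d, symmetric])
       (auto intro!: dirD_cong[OF S] simp: linear_scale L)
qed

section \<open>Symmetry of second directional derivatives\<close>

lemma dirD_line:
  assumes "F differentiable (at (p + s *\<^sub>R u))"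
  shows "((\<lambda>s. F (p + s *\<^sub>R u)) has_derivative (\<lambda>r. r *\<^sub>R dirD F (p + s *\<^sub>R u) u)) (at s)"
proof -
  have "((\<lambda>s. p + s *\<^sub>R u) has_derivative (\<lambda>r. r *\<^sub>R u)) (at s)"
    by (auto intro!: derivative_eq_intros)
  from has_derivative_compose[OF this has_dirD[OF assms]] show ?thesis
    by (simp add: linear_scale[OF linear_dirD[OF assms]])
qed

text \<open>The second difference of \<open>F\<close> is expressed through \<open>D\<^sub>v D\<^sub>u F\<close> by two applications of the mean
  value theorem.\<close>

lemma second_difference:
  fixes F :: "'e::euclidean_space \<Rightarrow> real"
  assumes F: "smooth_on S F" and t: "0 < t"
    and sub: "\<forall>r\<in>{0..t}. \<forall>s\<in>{0..t}. x + r *\<^sub>R u + s *\<^sub>R v \<in> S"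
  obtains r s where "0 < r" "r < t" "0 < s" "s < t"
    "F (x + t *\<^sub>R u + t *\<^sub>R v) - F (x + t *\<^sub>R u) - F (x + t *\<^sub>R v) + F x
     = t * t * dirD (\<lambda>y. dirD F y u) (x + r *\<^sub>R u + s *\<^sub>R v) v"
proof -
  have dF: "F differentiable (at (x + r *\<^sub>R u + s *\<^sub>R v))"
    and dD: "(\<lambda>y. dirD F y u) differentiable (at (x + r *\<^sub>R u + s *\<^sub>R v))"
    if "0 \<le> r" "r \<le> t" "0 \<le> s" "s \<le> t" for r s
    using smooth_on_differentiable[OF F] smooth_on_differentiable[OF smooth_on_dirD[OF F]] sub that by auto
  let ?\<phi> = "\<lambda>r. F (x + r *\<^sub>R u + t *\<^sub>R v) - F (x + r *\<^sub>R u)"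
  have "(?\<phi> has_derivative
      (\<lambda>q. q *\<^sub>R dirD F (x + r *\<^sub>R u + t *\<^sub>R v) u - q *\<^sub>R dirD F (x + r *\<^sub>R u) u)) (at r)"
    if "0 \<le> r" "r \<le> t" for r
    using dirD_line[of F "x + t *\<^sub>R v" r u] dirD_line[of F x r u] dF[OF that, of t] dF[OF that, of 0] t
    by (intro has_derivative_diff) (auto simp: algebra_simps)
  then obtain r where r: "0 < r" "r < t" "?\<phi> t - ?\<phi> 0
      = t *\<^sub>R dirD F (x + r *\<^sub>R u + t *\<^sub>R v) u - t *\<^sub>R dirD F (x + r *\<^sub>R u) u"
    using mvt_simple[OF t has_derivative_at_withinI, of ?\<phi>
      "\<lambda>r q. q *\<^sub>R dirD F (x + r *\<^sub>R u + t *\<^sub>R v) u - q *\<^sub>R dirD F (x + r *\<^sub>R u) u"] by auto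
  have "((\<lambda>s. dirD F (x + r *\<^sub>R u + s *\<^sub>R v) u) has_derivative
      (\<lambda>q. q *\<^sub>R dirD (\<lambda>y. dirD F y u) (x + r *\<^sub>R u + s *\<^sub>R v) v)) (at s)"
    if "0 \<le> s" "s \<le> t" for s
    using dirD_line[OF dD] that r by simp
  then obtain s where s: "0 < s" "s < t"
    "dirD F (x + r *\<^sub>R u + t *\<^sub>R v) u - dirD F (x + r *\<^sub>R u + 0 *\<^sub>R v) u
      = t *\<^sub>R dirD (\<lambda>y. dirD F y u) (x + r *\<^sub>R u + s *\<^sub>R v) v"
    using mvt_simple[OF t has_derivative_at_withinI, of "\<lambda>s. dirD F (x + r *\<^sub>R u + s *\<^sub>R v) u"
      "\<lambda>s q. q *\<^sub>R dirD (\<lambda>y. dirD F y u) (x + r *\<^sub>R u + s *\<^sub>R v) v"] by auto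
  show ?thesis
    using r s by (intro that[OF r(1,2) s(1,2)]) (simp add: algebra_simps)
qed

text \<open>On a small parallelogram at \<open>x\<close> the same second difference is
  \<open>t * t\<close> times a value of either mixed derivative, so the two take a common value near
  \<open>x\<close>. If they differed at \<open>x\<close> by \<open>2 * e\<close>, continuity would
  keep them apart there.\<close>

lemma dirD_commute_real:
  fixes F :: "'e::euclidean_space \<Rightarrow> real"
  assumes S: "open S" "x \<in> S" and F: "smooth_on S F"
  shows "dirD (\<lambda>y. dirD F y u) x v = dirD (\<lambda>y. dirD F y v) x u"
proof (rule ccontr)
  let ?A = "\<lambda>y. dirD (\<lambda>y. dirD F y u) y v" and ?B = "\<lambda>y. dirD (\<lambda>y. dirD F y v) y u"
  assume "?A x \<noteq> ?B x"
  define e where "e = \<bar>?A x - ?B x\<bar> / 2"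
  have e: "e > 0" using \<open>?A x \<noteq> ?B x\<close> by (simp add: e_def)
  have "continuous (at x) ?A" "continuous (at x) ?B"
    using S smooth_on_continuous[OF smooth_on_dirD[OF smooth_on_dirD[OF F]]]
    by (auto simp: continuous_on_eq_continuous_at)
  then obtain d1 d2 where d: "d1 > 0" "\<And>y. dist y x < d1 \<Longrightarrow> dist (?A y) (?A x) < e"
    "d2 > 0" "\<And>y. dist y x < d2 \<Longrightarrow> dist (?B y) (?B x) < e"
    using e unfolding continuous_at_eps_delta by metis
  obtain d3 where d3: "d3 > 0" "ball x d3 \<subseteq> S" using S open_contains_ball by blast
  define d where "d = min d1 (min d2 d3)"
  \<comment> \<open>With this side length all points of the parallelogram lie within
    \<open>d / 2\<close> of \<open>x\<close>; the summand 1 keeps the denominator positive when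
    \<open>u\<close> and \<open>v\<close> vanish.\<close>
  define t where "t = d / (2 * (norm u + norm v + 1))"
  have n: "norm u + norm v + 1 > 0" by (simp add: add_nonneg_pos)
  have "d > 0" using d d3 by (simp add: d_def)
  then have t: "t > 0" using n by (simp add: t_def)
  have near: "dist (x + r *\<^sub>R u + s *\<^sub>R v) x < d" if "0 \<le> r" "r \<le> t" "0 \<le> s" "s \<le> t" for r s
  proof -
    have "dist (x + r *\<^sub>R u + s *\<^sub>R v) x \<le> r * norm u + s * norm v"
      using norm_triangle_ineq[of "r *\<^sub>R u" "s *\<^sub>R v"] that by (simp add: dist_norm algebra_simps)
    also have "\<dots> \<le> t * norm u + t * norm v" using that by (intro add_mono mult_right_mono) auto
    also have "\<dots> \<le> t * (norm u + norm v + 1)" using t by (simp add: algebra_simps)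
    also have "\<dots> = d / 2" 
    proof -
      have "d / (2 * N) * N = d / 2" if "N > 0" for N :: real using that by simp
      then show ?thesis using n unfolding t_def by blast
    qed
    finally show ?thesis using \<open>d > 0\<close> by simp
  qed
  have sub: "\<forall>r\<in>{0..t}. \<forall>s\<in>{0..t}. x + r *\<^sub>R u + s *\<^sub>R v \<in> S"
    using near d3 by (fastforce simp: d_def dist_commute)
  then have sub': "\<forall>s\<in>{0..t}. \<forall>r\<in>{0..t}. x + s *\<^sub>R v + r *\<^sub>R u \<in> S"
    by (simp add: add.assoc add.commute[of "_ *\<^sub>R u"])
  obtain r s where 1: "0 < r" "r < t" "0 < s" "s < t"
    "F (x + t *\<^sub>R u + t *\<^sub>R v) - F (x + t *\<^sub>R u) - F (x + t *\<^sub>R v) + F x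
     = t * t * ?A (x + r *\<^sub>R u + s *\<^sub>R v)"
    using second_difference[OF F t sub] by blast
  obtain s' r' where 2: "0 < s'" "s' < t" "0 < r'" "r' < t"
    "F (x + t *\<^sub>R v + t *\<^sub>R u) - F (x + t *\<^sub>R v) - F (x + t *\<^sub>R u) + F x
     = t * t * ?B (x + s' *\<^sub>R v + r' *\<^sub>R u)"
    using second_difference[OF F t sub'] by blast
  have "F (x + t *\<^sub>R v + t *\<^sub>R u) = F (x + t *\<^sub>R u + t *\<^sub>R v)" by (simp add: ac_simps)
  with 1 2 have "t * t * ?A (x + r *\<^sub>R u + s *\<^sub>R v) = t * t * ?B (x + s' *\<^sub>R v + r' *\<^sub>R u)" by linarith
  then have "?A (x + r *\<^sub>R u + s *\<^sub>R v) = ?B (x + s' *\<^sub>R v + r' *\<^sub>R u)" using t by simp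
  moreover have "dist (?A (x + r *\<^sub>R u + s *\<^sub>R v)) (?A x) < e"
    using near[of r s] 1 d by (simp add: d_def)
  moreover have "dist (?B (x + s' *\<^sub>R v + r' *\<^sub>R u)) (?B x) < e"
    using near[of r' s'] 2 d by (simp add: d_def ac_simps)
  ultimately show False by (simp add: e_def dist_real_def abs_if split: if_splits)
qed

lemma dirD_commute:
  fixes F :: "'e::euclidean_space \<Rightarrow> 'f::euclidean_space"
  assumes S: "open S" "x \<in> S" and F: "smooth_on S F"
  shows "dirD (\<lambda>y. dirD F y u) x v = dirD (\<lambda>y. dirD F y v) x u"
proof (rule euclidean_eqI)
  fix b :: 'f
  have 1: "dirD F y w \<bullet> b = dirD (\<lambda>z. F z \<bullet> b) y w" if "y \<in> S" for y w
    by (rule dirD_linear_o[OF bounded_linear_inner_left smooth_on_differentiable[OF F that], symmetric])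
  have 2: "dirD (\<lambda>y. dirD F y w) x z \<bullet> b = dirD (\<lambda>y. dirD (\<lambda>z. F z \<bullet> b) y w) x z" for w z
    by (subst dirD_cong[OF S 1, symmetric], assumption)
       (rule dirD_linear_o[OF bounded_linear_inner_left smooth_on_differentiable[OF smooth_on_dirD[OF F] S(2)],
          symmetric])
  show "dirD (\<lambda>y. dirD F y u) x v \<bullet> b = dirD (\<lambda>y. dirD F y v) x u \<bullet> b"
    unfolding 2 by (rule dirD_commute_real[OF S smooth_on_inner[OF S(1) F]])
qed

text \<open>A product rule in which one factor is merely continuous: its missing derivative would be
  multiplied by \<open>\<phi> x = 0\<close>. It serves to differentiate the dual basis when only its
  continuity is known.\<close>

lemma has_derivative_mult_vanishing:
  fixes \<phi> \<psi> :: "'e::euclidean_space \<Rightarrow> real"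
  assumes \<phi>: "(\<phi> has_derivative D) (at x)" "\<phi> x = 0" and \<psi>: "continuous (at x) \<psi>"
  shows "((\<lambda>y. \<phi> y * \<psi> y) has_derivative (\<lambda>v. D v * \<psi> x)) (at x)"
proof -
  have bl: "bounded_linear D" using \<phi>(1) has_derivative_bounded_linear by blast
  then obtain K where K: "K > 0" "\<And>v. norm (D v) \<le> norm v * K"
    using bounded_linear.pos_bounded by blast
  have r: "(\<lambda>v. norm (\<phi> (x + v) - D v) / norm v) \<midarrow>0\<rightarrow> 0"
    using \<phi> by (simp add: has_derivative_at)
  have c: "(\<lambda>v. \<psi> (x + v)) \<midarrow>0\<rightarrow> \<psi> x"
    using \<psi> by (simp add: continuous_at LIM_offset_zero)
  have lim: "(\<lambda>v. norm (\<phi> (x + v) - D v) / norm v * \<bar>\<psi> (x + v)\<bar> + K * \<bar>\<psi> (x + v) - \<psi> x\<bar>) \<midarrow>0\<rightarrow> 0"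
    using tendsto_add[OF tendsto_mult[OF r tendsto_rabs[OF c]]
        tendsto_mult[OF tendsto_const[of K] tendsto_rabs[OF tendsto_diff[OF c tendsto_const[of "\<psi> x"]]]]]
    by simp
  have "norm (norm (\<phi> (x + v) * \<psi> (x + v) - \<phi> x * \<psi> x - D v * \<psi> x) / norm v)
      \<le> norm (\<phi> (x + v) - D v) / norm v * \<bar>\<psi> (x + v)\<bar> + K * \<bar>\<psi> (x + v) - \<psi> x\<bar>"
    if "v \<noteq> 0" for v
  proof -
    have "norm (\<phi> (x + v) * \<psi> (x + v) - \<phi> x * \<psi> x - D v * \<psi> x)
        = \<bar>(\<phi> (x + v) - D v) * \<psi> (x + v) + D v * (\<psi> (x + v) - \<psi> x)\<bar>"
      using \<phi>(2) by (simp add: algebra_simps)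
    also have "\<dots> \<le> \<bar>\<phi> (x + v) - D v\<bar> * \<bar>\<psi> (x + v)\<bar> + \<bar>D v\<bar> * \<bar>\<psi> (x + v) - \<psi> x\<bar>"
      by (metis abs_mult abs_triangle_ineq)
    also have "\<dots> \<le> \<bar>\<phi> (x + v) - D v\<bar> * \<bar>\<psi> (x + v)\<bar> + (norm v * K) * \<bar>\<psi> (x + v) - \<psi> x\<bar>"
      using K(2)[of v] by (intro add_left_mono mult_right_mono) auto
    finally show ?thesis using that by (simp add: field_simps)
  qed
  then have "(\<lambda>v. norm (\<phi> (x + v) * \<psi> (x + v) - \<phi> x * \<psi> x - D v * \<psi> x) / norm v) \<midarrow>0\<rightarrow> 0"
    by (intro Lim_null_comparison[OF _ lim]) (auto simp: eventually_at intro!: exI[of _ 1])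
  then show ?thesis
    using bounded_linear_mult_const[OF bl] by (simp add: has_derivative_at)
qed

lemma linear_divide: "linear f \<Longrightarrow> linear (\<lambda>x. f x / (c::real))"
  by (simp add: linear_iff add_divide_distrib)

lemma linear_o: "linear g \<Longrightarrow> linear f \<Longrightarrow> linear (\<lambda>x. g (f x))"
  using linear_compose[of f g] by (simp add: o_def)

section \<open>Pseudo-Riemannian metrics in a chart\<close>

text \<open>Captures one chart image with its local metric. The model space is arbitrary, so that
  \<open>J \<times> U\<close> inside \<open>real \<times> 'e\<close> is an instance as well.\<close>

locale coordinate_metric =
  fixes U :: "'e::euclidean_space set" and h :: "'e local_metric"
  assumes open_U: "open U"
    and bilin: "x \<in> U \<Longrightarrow> bilinear (h x)"
    and sym: "x \<in> U \<Longrightarrow> h x u v = h x v u"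
    and nondeg: "x \<in> U \<Longrightarrow> (\<And>v. h x u v = 0) \<Longrightarrow> u = 0"
    and smooth_metric: "smooth_on U (\<lambda>x. h x u v)"
begin

lemmas smooth_U = smooth_metric smooth_on_const smooth_on_dirD
  smooth_on_add[OF open_U] smooth_on_diff[OF open_U] smooth_on_minus[OF open_U]
  smooth_on_mult[OF open_U] smooth_on_scaleR[OF open_U] smooth_on_sum[OF open_U]
  smooth_on_inner[OF open_U]

lemma linear_left: "x \<in> U \<Longrightarrow> linear (\<lambda>u. h x u v)"
  and linear_right: "x \<in> U \<Longrightarrow> linear (h x u)"
  using bilin by (auto simp: bilinear_def)

section \<open>Raising indices and the dual basis\<close>

lemma metric_eqI: "x \<in> U \<Longrightarrow> (\<And>w. h x u w = h x v w) \<Longrightarrow> u = v"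
  using nondeg[of x "u - v"] linear_diff[OF linear_left] by simp

lemma sharp_eqI: "x \<in> U \<Longrightarrow> (\<And>w. h x v w = \<alpha> w) \<Longrightarrow> sharp h x \<alpha> = v"
  unfolding sharp_def by (rule the_equality) (auto intro: metric_eqI)

text \<open>The map \<open>?G\<close> lowers the index. Nondegeneracy makes it injective, and finite
  dimension then makes it surjective, so the definite description in \<open>sharp\<close>
  denotes.\<close>

lemma metric_sharp:
  assumes x: "x \<in> U" and \<alpha>: "linear \<alpha>"
  shows "h x (sharp h x \<alpha>) w = \<alpha> w"
proof -
  let ?G = "\<lambda>v. \<Sum>b\<in>Basis. h x v b *\<^sub>R b"
  have G: "?G v \<bullet> b = h x v b" if "b \<in> Basis" for v b
    using that by (simp add: inner_sum_left inner_Basis if_distrib cong: if_cong)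
  have lin: "linear ?G"
    by (rule linearI)
       (simp_all add: linear_add[OF linear_left[OF x]] linear_scale[OF linear_left[OF x]]
         scaleR_add_left sum.distrib scaleR_sum_right)
  have "inj ?G"
    unfolding linear_injective_0[OF lin]
  proof (intro allI impI)
    fix v assume 0: "?G v = 0"
    have b: "h x v b = 0" if "b \<in> Basis" for b using G[OF that, of v] 0 by simp
    then have "h x v w = 0" for w
      by (subst linear_Basis_expand[OF linear_right[OF x]]) simp
    then show "v = 0" using nondeg[OF x] by blast
  qed
  then have "surj ?G" by (rule linear_injective_imp_surjective[OF lin _ refl])
  then obtain v where v: "(\<Sum>b\<in>Basis. \<alpha> b *\<^sub>R b) = ?G v" by (rule surjE)
  have "h x v b = \<alpha> b" if "b \<in> Basis" for b
    unfolding G[OF that, symmetric] v[symmetric]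
    using that by (simp add: inner_sum_left inner_Basis if_distrib cong: if_cong)
  then have *: "h x v w = \<alpha> w" for w
    unfolding linear_Basis_expand[OF linear_right[OF x], of v w] linear_Basis_expand[OF \<alpha>, of w] by simp
  show ?thesis using sharp_eqI[OF x *] * by simp
qed

text \<open>The metric gradient of the linear coordinate \<open>\<lambda>w. w \<bullet> b\<close>;
  its components are a row of the inverse metric. Metric traces are sums over the pairs
  \<open>dual b x\<close>, \<open>b\<close>.\<close>

definition dual :: "'e \<Rightarrow> 'e \<Rightarrow> 'e" where
  "dual b x = sharp h x (\<lambda>w. w \<bullet> b)"

lemma metric_dual: "x \<in> U \<Longrightarrow> h x (dual b x) w = w \<bullet> b"
  unfolding dual_def
  by (rule metric_sharp) (simp_all add: bounded_linear.linear bounded_linear_inner_left)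

lemma metric_dual': "x \<in> U \<Longrightarrow> h x w (dual b x) = w \<bullet> b"
  using metric_dual sym by metis

lemma dual_expand:
  assumes x: "x \<in> U" shows "v = (\<Sum>b\<in>Basis. h x v b *\<^sub>R dual b x)"
proof (rule metric_eqI[OF x])
  fix w
  have "h x (\<Sum>b\<in>Basis. h x v b *\<^sub>R dual b x) w = (\<Sum>b\<in>Basis. h x v b * (w \<bullet> b))"
    by (simp add: linear_sum[OF linear_left[OF x]] linear_scale[OF linear_left[OF x]] metric_dual[OF x])
  also have "\<dots> = h x v w"
    by (subst linear_Basis_expand[OF linear_right[OF x], of v w]) (simp add: mult.commute)
  finally show "h x v w = h x (\<Sum>b\<in>Basis. h x v b *\<^sub>R dual b x) w" by simp
qed

lemma dual_component_sym: "x \<in> U \<Longrightarrow> dual b x \<bullet> c = dual c x \<bullet> b"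
  using metric_dual metric_dual' by metis

text \<open>The inverse metric is symmetric, so it does not matter which of the two slots receives
  the raised vector.\<close>

lemma trace_swap:
  fixes T :: "'e \<Rightarrow> 'e \<Rightarrow> real"
  assumes x: "x \<in> U" and T: "\<And>v. linear (\<lambda>u. T u v)" "\<And>u. linear (T u)"
  shows "(\<Sum>b\<in>Basis. T (dual b x) b) = (\<Sum>b\<in>Basis. T b (dual b x))"
proof -
  have "(\<Sum>b\<in>Basis. T (dual b x) b) = (\<Sum>b\<in>Basis. \<Sum>c\<in>Basis. (dual b x \<bullet> c) * T c b)"
    by (subst linear_Basis_expand[OF T(1)]) simp
  also have "\<dots> = (\<Sum>c\<in>Basis. \<Sum>b\<in>Basis. (dual c x \<bullet> b) * T c b)"
    by (subst sum.swap) (simp add: dual_component_sym[OF x])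
  also have "\<dots> = (\<Sum>c\<in>Basis. T c (dual c x))"
    by (subst linear_Basis_expand[OF T(2)]) simp
  finally show ?thesis .
qed

text \<open>This identity yields the continuity and the derivative of the dual basis, hence its smoothness,
  without determinants.\<close>

lemma dual_diff:
  assumes x: "x \<in> U" and y: "y \<in> U"
  shows "dual b y - dual b x
    = (\<Sum>c\<in>Basis. \<Sum>d\<in>Basis. ((h x c d - h y c d) * (dual b y \<bullet> c)) *\<^sub>R dual d x)"
proof (rule metric_eqI[OF x])
  fix w
  have e: "h z u w = (\<Sum>c\<in>Basis. \<Sum>d\<in>Basis. (u \<bullet> c) * (w \<bullet> d) * h z c d)" if "z \<in> U" for z u
    by (subst linear_Basis_expand[OF linear_left[OF that]], subst linear_Basis_expand[OF linear_right[OF that]])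
       (simp add: sum_distrib_left mult.assoc)
  have "h x (dual b y - dual b x) w = h x (dual b y) w - h y (dual b y) w"
    by (simp add: linear_diff[OF linear_left[OF x]] metric_dual x y)
  also have "\<dots> = (\<Sum>c\<in>Basis. \<Sum>d\<in>Basis. (h x c d - h y c d) * (dual b y \<bullet> c) * (w \<bullet> d))"
    unfolding e[OF x] e[OF y] by (simp add: sum_subtractf[symmetric] algebra_simps)
  also have "\<dots> = h x (\<Sum>c\<in>Basis. \<Sum>d\<in>Basis. ((h x c d - h y c d) * (dual b y \<bullet> c)) *\<^sub>R dual d x) w"
    by (simp add: linear_sum[OF linear_left[OF x]] linear_scale[OF linear_left[OF x]] metric_dual[OF x])
  finally show "h x (dual b y - dual b x) w = \<dots>" .
qed

text \<open>\<open>dual_diff\<close> bounds the increment by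
  \<open>\<epsilon> y * norm (dual b y)\<close>, which still contains the unknown value at
  \<open>y\<close>. Once \<open>\<epsilon> y < 1 / 2\<close> this term is absorbed, giving
  \<open>norm (dual b y) \<le> 2 * norm (dual b x)\<close> and a bound that tends to 0.\<close>

lemma continuous_dual:
  assumes x: "x \<in> U" shows "continuous (at x) (dual b)"
proof -
  define \<epsilon> where "\<epsilon> y = (\<Sum>c\<in>Basis. \<Sum>d\<in>Basis. \<bar>h x c d - h y c d\<bar> * norm (dual d x))" for y
  have "continuous (at x) (\<lambda>y. h y c d)" for c d
    using smooth_on_continuous[OF smooth_metric] x open_U by (auto simp: continuous_on_eq_continuous_at)
  then have "continuous (at x) \<epsilon>"
    unfolding \<epsilon>_def by (intro continuous_intros)
  moreover have "\<epsilon> x = 0" by (simp add: \<epsilon>_def)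
  ultimately have \<epsilon>0: "(\<epsilon> \<longlongrightarrow> 0) (at x)" by (simp add: continuous_at)
  have le: "norm (dual b y - dual b x) \<le> \<epsilon> y * norm (dual b y)" if y: "y \<in> U" for y
  proof -
    have "norm (dual b y - dual b x)
        \<le> (\<Sum>c\<in>Basis. \<Sum>d\<in>Basis. norm (((h x c d - h y c d) * (dual b y \<bullet> c)) *\<^sub>R dual d x))"
      unfolding dual_diff[OF x y] by (intro order_trans[OF norm_sum] sum_mono norm_sum)
    also have "\<dots> \<le> (\<Sum>c\<in>Basis. \<Sum>d\<in>Basis. \<bar>h x c d - h y c d\<bar> * norm (dual d x) * norm (dual b y))"
    proof (intro sum_mono)
      fix c d :: 'e assume "c \<in> Basis"
      then have "\<bar>h x c d - h y c d\<bar> * norm (dual d x) * \<bar>dual b y \<bullet> c\<bar>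
          \<le> \<bar>h x c d - h y c d\<bar> * norm (dual d x) * norm (dual b y)"
        by (intro mult_left_mono Basis_le_norm) auto
      then show "norm (((h x c d - h y c d) * (dual b y \<bullet> c)) *\<^sub>R dual d x)
          \<le> \<bar>h x c d - h y c d\<bar> * norm (dual d x) * norm (dual b y)"
        by (simp add: abs_mult ac_simps)
    qed
    finally show ?thesis by (simp add: \<epsilon>_def sum_distrib_right)
  qed
  have ev: "\<forall>\<^sub>F y in at x. norm (dual b y - dual b x) \<le> \<epsilon> y * (2 * norm (dual b x))"
  proof -
    have "\<forall>\<^sub>F y in at x. \<epsilon> y < 1 / 2" using \<epsilon>0 by (rule order_tendstoD) simp
    moreover have "\<forall>\<^sub>F y in at x. y \<in> U" using open_U x by (rule eventually_at_in_open')
    ultimately show ?thesis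
    proof eventually_elim
      case (elim y)
      have \<epsilon>: "0 \<le> \<epsilon> y" unfolding \<epsilon>_def by (intro sum_nonneg) simp
      have "\<epsilon> y * norm (dual b y) \<le> 1 / 2 * norm (dual b y)"
        using elim(1) by (intro mult_right_mono) auto
      then have "norm (dual b y) \<le> 2 * norm (dual b x)"
        using le[OF elim(2)] norm_triangle_sub[of "dual b y" "dual b x"] by linarith
      then show ?case using le[OF elim(2)] mult_left_mono[OF _ \<epsilon>] order_trans by blast
    qed
  qed
  have "((\<lambda>y. \<epsilon> y * (2 * norm (dual b x))) \<longlongrightarrow> 0) (at x)"
    using tendsto_mult_left_zero[OF \<epsilon>0] by simp
  then have "((\<lambda>y. dual b y - dual b x) \<longlongrightarrow> 0) (at x)"
    using ev by (rule Lim_null_comparison[rotated])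
  then show ?thesis by (simp add: continuous_at LIM_zero_iff)
qed

text \<open>The rule d(h^-1) = - h^-1 (dh) h^-1. Each coefficient in \<open>dual_diff\<close> is a
  factor vanishing at \<open>x\<close> times a component of \<open>dual b y\<close>, so continuity
  of the latter suffices.\<close>

lemma has_derivative_dual:
  assumes x: "x \<in> U"
  shows "(dual b has_derivative (\<lambda>v. \<Sum>c\<in>Basis. \<Sum>d\<in>Basis.
           (- dirD (\<lambda>y. h y c d) x v * (dual b x \<bullet> c)) *\<^sub>R dual d x)) (at x)"
proof -
  have d: "((\<lambda>y. h x c d - h y c d) has_derivative (\<lambda>v. 0 - dirD (\<lambda>y. h y c d) x v)) (at x)" for c d
    by (intro has_derivative_diff has_derivative_const has_dirD smooth_on_differentiable[OF smooth_metric x])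
  have "((\<lambda>y. (h x c d - h y c d) * (dual b y \<bullet> c)) has_derivative
      (\<lambda>v. (0 - dirD (\<lambda>y. h y c d) x v) * (dual b x \<bullet> c))) (at x)" for c d
    by (rule has_derivative_mult_vanishing[OF d])
       (simp, rule continuous_inner[OF continuous_dual[OF x] continuous_const])
  then have *: "((\<lambda>y. dual b x + (\<Sum>c\<in>Basis. \<Sum>d\<in>Basis.
        ((h x c d - h y c d) * (dual b y \<bullet> c)) *\<^sub>R dual d x)) has_derivative
      (\<lambda>v. 0 + (\<Sum>c\<in>Basis. \<Sum>d\<in>Basis.
        ((0 - dirD (\<lambda>y. h y c d) x v) * (dual b x \<bullet> c)) *\<^sub>R dual d x))) (at x)"
    by (intro has_derivative_add has_derivative_const has_derivative_sum has_derivative_scaleR_left)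
  have "(dual b has_derivative (\<lambda>v. 0 + (\<Sum>c\<in>Basis. \<Sum>d\<in>Basis.
        ((0 - dirD (\<lambda>y. h y c d) x v) * (dual b x \<bullet> c)) *\<^sub>R dual d x))) (at x)"
    by (rule has_derivative_transform_within_open[OF * open_U x]) (simp add: dual_diff[OF x, symmetric])
  then show ?thesis by (simp only: diff_0 add_0)
qed

text \<open>Bootstrapping: the derivative is a polynomial in the dual basis and first derivatives of
  the metric, so class C^k for all dual vectors yields class C^(k+1).\<close>

lemma smooth_dual: "smooth_on U (dual b)"
  unfolding smooth_on_def
proof
  fix k show "Ck_on k U (dual b)"
  proof (induction k arbitrary: b)
    case 0
    show ?case using continuous_dual by (auto intro: continuous_at_imp_continuous_on)
  next
    case (Suc k)
    have "Ck_on k U (\<lambda>x. - dirD (\<lambda>y. h y c d) x v)" for c d v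
      using smooth_on_minus[OF open_U smooth_on_dirD[OF smooth_metric]] by (auto simp: smooth_on_def)
    then show ?case
      by (intro Ck_on_SucI[OF open_U has_derivative_dual] Ck_on_sum Ck_on_scaleR Ck_on_mult open_U Suc
          Ck_on_linear_o[OF open_U bounded_linear_inner_left])
  qed
qed

subsection \<open>The Levi-Civita connection\<close>

text \<open>The Christoffel symbols of the first kind, that is, the covector to which
  \<open>christoffel\<close> applies \<open>sharp\<close>.\<close>

definition koszul :: "'e \<Rightarrow> 'e \<Rightarrow> 'e \<Rightarrow> 'e \<Rightarrow> real" where
  "koszul x u v w =
     (dirD (\<lambda>y. h y v w) x u + dirD (\<lambda>y. h y u w) x v - dirD (\<lambda>y. h y u v) x w) / 2"

abbreviation \<Gamma> :: "'e \<Rightarrow> 'e \<Rightarrow> 'e \<Rightarrow> 'e" where "\<Gamma> \<equiv> christoffel h"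

lemma diff_metric: "x \<in> U \<Longrightarrow> (\<lambda>y. h y u v) differentiable (at x)"
  by (rule smooth_on_differentiable[OF smooth_metric])

lemma linear_dirD_metric:
  assumes "x \<in> U"
  shows "linear (\<lambda>u. dirD (\<lambda>y. h y u w) x v)" "linear (\<lambda>w. dirD (\<lambda>y. h y u w) x v)"
    "linear (\<lambda>v. dirD (\<lambda>y. h y u w) x v)"
  using linear_dirD_param[OF open_U assms, of "\<lambda>y u. h y u w"]
    linear_dirD_param[OF open_U assms, of "\<lambda>y. h y u"] linear_dirD[OF diff_metric[OF assms]]
  by (simp_all add: linear_left linear_right smooth_metric)

lemma linear_koszul:
  assumes x: "x \<in> U"
  shows "linear (\<lambda>w. koszul x u v w)" "linear (\<lambda>v. koszul x u v w)" "linear (\<lambda>u. koszul x u v w)"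
  unfolding koszul_def
  by (intro linear_divide linear_compose_sub linear_compose_add linear_dirD_metric x)+

lemma metric_christoffel: "x \<in> U \<Longrightarrow> h x (\<Gamma> x u v) w = koszul x u v w"
  unfolding christoffel_def koszul_def[symmetric] by (rule metric_sharp[OF _ linear_koszul(1)])

lemma dirD_metric_sym: "x \<in> U \<Longrightarrow> dirD (\<lambda>y. h y u v) x w = dirD (\<lambda>y. h y v u) x w"
  by (rule dirD_cong[OF open_U]) (auto intro: sym)

lemma christoffel_sym:
  assumes x: "x \<in> U" shows "\<Gamma> x u v = \<Gamma> x v u"
  by (rule metric_eqI[OF x]) (simp add: x metric_christoffel koszul_def dirD_metric_sym[of x u v])

lemma linear_christoffel:
  assumes x: "x \<in> U" shows "linear (\<Gamma> x u)"
  by (rule linearI; rule metric_eqI[OF x])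
     (simp_all add: x metric_christoffel linear_add[OF linear_left] linear_scale[OF linear_left]
       linear_add[OF linear_koszul(2)] linear_scale[OF linear_koszul(2)])

lemma linear_christoffel': "x \<in> U \<Longrightarrow> linear (\<lambda>u. \<Gamma> x u v)"
proof -
  assume x: "x \<in> U"
  have "(\<lambda>u. \<Gamma> x u v) = \<Gamma> x v" by (rule ext) (rule christoffel_sym[OF x])
  then show ?thesis using linear_christoffel[OF x] by simp
qed

lemma smooth_christoffel: "smooth_on U (\<lambda>x. \<Gamma> x u v)"
proof (rule smooth_on_cong[OF open_U])
  show "(\<Sum>b\<in>Basis. koszul x u v b *\<^sub>R dual b x) = \<Gamma> x u v" if "x \<in> U" for x
    using dual_expand[OF that, of "\<Gamma> x u v"] metric_christoffel[OF that] by simp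
  have "smooth_on U (\<lambda>x. 1 / 2 * (dirD (\<lambda>y. h y v b) x u + dirD (\<lambda>y. h y u b) x v - dirD (\<lambda>y. h y u v) x b))" for b
    by (intro smooth_U)
  then show "smooth_on U (\<lambda>x. \<Sum>b\<in>Basis. koszul x u v b *\<^sub>R dual b x)"
    unfolding koszul_def by (intro smooth_on_sum smooth_on_scaleR open_U smooth_dual) simp
qed

text \<open>Directions are constant fields, so their brackets vanish. The differentiated field is
  arbitrary, which allows iteration as in \<open>N v (N u Y)\<close>.\<close>

abbreviation N :: "'e \<Rightarrow> ('e \<Rightarrow> 'e) \<Rightarrow> 'e \<Rightarrow> 'e" where
  "N v Y \<equiv> nabla h (\<lambda>_. v) Y"

lemma smooth_christoffel_field: "smooth_on U Y \<Longrightarrow> smooth_on U (\<lambda>y. \<Gamma> y u (Y y))"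
  by (rule smooth_on_linear_field[OF open_U linear_christoffel smooth_christoffel])

lemma smooth_nabla: "smooth_on U Y \<Longrightarrow> smooth_on U (N v Y)"
  unfolding nabla_def by (intro smooth_on_add open_U smooth_on_dirD smooth_christoffel_field)

lemma nabla_cong:
  assumes "x \<in> U" "\<And>y. y \<in> U \<Longrightarrow> Y y = Z y"
  shows "N v Y x = N v Z x"
  using assms dirD_cong[OF open_U assms] by (simp add: nabla_def)

lemma nabla_diff:
  assumes x: "x \<in> U" and Y: "smooth_on U Y" and Z: "smooth_on U Z"
  shows "N v (\<lambda>y. Y y - Z y) x = N v Y x - N v Z x"
  by (simp add: nabla_def dirD_diff smooth_on_differentiable[OF Y x] smooth_on_differentiable[OF Z x]
      linear_diff[OF linear_christoffel[OF x]])

lemma smooth_inner_fields: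
  assumes Y: "smooth_on U Y" and Z: "smooth_on U Z"
  shows "smooth_on U (\<lambda>y. h y (Y y) (Z y))"
  by (rule smooth_on_linear_field[OF open_U, of "\<lambda>y. h y (Y y)"])
     (auto intro!: linear_right Z smooth_on_linear_field[OF open_U _ _ Y, of "\<lambda>y u. h y u _"]
       linear_left smooth_metric)

text \<open>Compatibility of the connection with the metric. Two Leibniz steps reduce it to constant
  fields, where adding the Koszul expressions with \<open>Y x\<close> and \<open>Z x\<close>
  exchanged leaves only the derivative along \<open>v\<close>.\<close>

lemma dirD_metric_fields:
  assumes x: "x \<in> U" and Y: "smooth_on U Y" and Z: "smooth_on U Z"
  shows "dirD (\<lambda>y. h y (Y y) (Z y)) x v = h x (N v Y x) (Z x) + h x (Y x) (N v Z x)"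
proof -
  have sY: "smooth_on U (\<lambda>y. h y (Y y) u)" for u
    by (rule smooth_inner_fields[OF Y smooth_on_const])
  have "dirD (\<lambda>y. h y (Y y) (Z y)) x v = dirD (\<lambda>y. h y (Y y) (Z x)) x v + h x (Y x) (dirD Z x v)"
    by (rule dirD_linear_field[OF open_U x, of "\<lambda>y. h y (Y y)"]) (auto intro: linear_right sY Z)
  also have "dirD (\<lambda>y. h y (Y y) (Z x)) x v = dirD (\<lambda>y. h y (Y x) (Z x)) x v + h x (dirD Y x v) (Z x)"
    by (rule dirD_linear_field[OF open_U x, of "\<lambda>y u. h y u (Z x)"]) (auto intro: linear_left smooth_metric Y)
  also have "dirD (\<lambda>y. h y (Y x) (Z x)) x v = h x (\<Gamma> x v (Y x)) (Z x) + h x (Y x) (\<Gamma> x v (Z x))"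
    unfolding sym[OF x, of "Y x" "\<Gamma> x v (Z x)"] metric_christoffel[OF x] koszul_def
    by (simp add: dirD_metric_sym[OF x, of "Z x" "Y x"] field_simps)
  finally show ?thesis
    by (simp add: nabla_def linear_add[OF linear_left[OF x]] linear_add[OF linear_right[OF x]])
qed

subsection \<open>Curvature\<close>

abbreviation R :: "'e \<Rightarrow> 'e \<Rightarrow> 'e \<Rightarrow> 'e \<Rightarrow> 'e" where
  "R x u v w \<equiv> riemann h (\<lambda>_. u) (\<lambda>_. v) (\<lambda>_. w) x"

lemma nabla_nabla:
  assumes x: "x \<in> U" and Y: "smooth_on U Y"
  shows "N v (N u Y) x = dirD (\<lambda>y. dirD Y y u) x v + dirD (\<lambda>y. \<Gamma> y u (Y x)) x v
    + \<Gamma> x u (dirD Y x v) + \<Gamma> x v (dirD Y x u) + \<Gamma> x v (\<Gamma> x u (Y x))"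
proof -
  have "dirD (N u Y) x v = dirD (\<lambda>y. dirD Y y u) x v + dirD (\<lambda>y. \<Gamma> y u (Y y)) x v"
    unfolding nabla_def
    by (rule dirD_add) (rule smooth_on_differentiable[OF _ x], intro smooth_on_dirD smooth_christoffel_field Y)+
  also have "dirD (\<lambda>y. \<Gamma> y u (Y y)) x v = dirD (\<lambda>y. \<Gamma> y u (Y x)) x v + \<Gamma> x u (dirD Y x v)"
    by (rule dirD_linear_field[OF open_U x]) (auto intro: linear_christoffel smooth_christoffel Y)
  finally show ?thesis
    by (simp add: nabla_def[of _ _ "N u Y"]) (simp add: nabla_def linear_add[OF linear_christoffel[OF x]])
qed

lemma riemann_eq_nabla: "R x u v w = N v (N u (\<lambda>_. w)) x - N u (N v (\<lambda>_. w)) x" if x: "x \<in> U"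
proof -
  have "lie_bracket (\<lambda>_. u) (\<lambda>_. v) = (\<lambda>_. 0)" by (simp add: lie_bracket_def fun_eq_iff)
  then show ?thesis by (simp add: riemann_def nabla_def[of _ "\<lambda>_. 0"] linear_0[OF linear_christoffel'[OF x]])
qed

lemma riemann_formula:
  assumes x: "x \<in> U"
  shows "R x u v w = dirD (\<lambda>y. \<Gamma> y u w) x v - dirD (\<lambda>y. \<Gamma> y v w) x u
    + \<Gamma> x v (\<Gamma> x u w) - \<Gamma> x u (\<Gamma> x v w)"
  unfolding riemann_eq_nabla[OF x] nabla_nabla[OF x smooth_on_const]
  by (simp add: linear_0[OF linear_christoffel[OF x]])

text \<open>The Ricci identity, which shows that curvature is tensorial: all derivatives of
  \<open>Y\<close> occur symmetrically in \<open>u\<close> and \<open>v\<close> and cancel, so only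
  \<open>Y x\<close> remains.\<close>

lemma nabla_commutator:
  assumes x: "x \<in> U" and Y: "smooth_on U Y"
  shows "N v (N u Y) x - N u (N v Y) x = R x u v (Y x)"
  unfolding riemann_formula[OF x] nabla_nabla[OF x Y]
  by (simp add: dirD_commute[OF open_U x Y, of u v])

lemma riemann_skew: "x \<in> U \<Longrightarrow> R x u v w = - R x v u w"
  by (simp add: riemann_formula)

lemma linear_riemann:
  assumes x: "x \<in> U"
  shows "linear (\<lambda>u. R x u v w)" "linear (\<lambda>v. R x u v w)" "linear (\<lambda>w. R x u v w)"
proof -
  have d: "linear (\<lambda>u. dirD (\<lambda>y. \<Gamma> y u w) x v)" "linear (\<lambda>w. dirD (\<lambda>y. \<Gamma> y u w) x v)"
    "linear (\<lambda>v. dirD (\<lambda>y. \<Gamma> y u w) x v)" for u v w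
    using linear_dirD_param[OF open_U x, of "\<lambda>y u. \<Gamma> y u w"]
      linear_dirD_param[OF open_U x, of "\<lambda>y. \<Gamma> y u"]
      linear_dirD[OF smooth_on_differentiable[OF smooth_christoffel x]]
    by (simp_all add: linear_christoffel linear_christoffel' smooth_christoffel)
  have c: "linear (\<lambda>u. \<Gamma> x v (\<Gamma> x u w))" "linear (\<lambda>v. \<Gamma> x v (\<Gamma> x u w))" "linear (\<lambda>w. \<Gamma> x v (\<Gamma> x u w))" for u v w
    by (intro linear_o[OF linear_christoffel[OF x]] linear_christoffel' linear_christoffel x)+
  show 1: "linear (\<lambda>u. R x u v w)" for u v w
    unfolding riemann_formula[OF x] by (intro linear_compose_sub linear_compose_add d c)
  show "linear (\<lambda>v. R x u v w)" "linear (\<lambda>w. R x u v w)"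
    unfolding riemann_formula[OF x] by (intro linear_compose_sub linear_compose_add d c)+
qed

lemma smooth_riemann: "smooth_on U (\<lambda>x. R x u v w)"
proof (rule smooth_on_cong[OF open_U])
  show "N v (N u (\<lambda>_. w)) x - N u (N v (\<lambda>_. w)) x = R x u v w" if "x \<in> U" for x
    using riemann_eq_nabla[OF that] by simp
qed (intro smooth_U smooth_nabla)

text \<open>Differentiate the function \<open>h y w z\<close> along \<open>u\<close> and
  \<open>v\<close> in both orders by metric compatibility. The mixed products are symmetric in the
  two directions, so what is left of the vanishing commutator is the sum of the two curvature
  terms.\<close>

lemma riemann4_skew_right:
  assumes x: "x \<in> U" shows "riemann4 h x u v w z = - riemann4 h x u v z w"
proof -
  let ?W = "\<lambda>_::'e. w" and ?Z = "\<lambda>_::'e. z"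
  have s: "smooth_on U (N a (\<lambda>_. c))" for a c by (rule smooth_nabla[OF smooth_on_const])
  have "dirD (\<lambda>y. dirD (\<lambda>y. h y w z) y a) x b = h x (N b (N a ?W) x) z + h x (N a ?W x) (N b ?Z x)
      + (h x (N b ?W x) (N a ?Z x) + h x w (N b (N a ?Z) x))" for a b
  proof -
    have "dirD (\<lambda>y. dirD (\<lambda>y. h y w z) y a) x b = dirD (\<lambda>y. h y (N a ?W y) z + h y w (N a ?Z y)) x b"
      by (rule dirD_cong[OF open_U x])
         (use dirD_metric_fields[OF _ smooth_on_const smooth_on_const, of _ w z a] in simp)
    also have "\<dots> = dirD (\<lambda>y. h y (N a ?W y) z) x b + dirD (\<lambda>y. h y w (N a ?Z y)) x b"
      by (rule dirD_add)
         (rule smooth_on_differentiable[OF _ x], intro smooth_inner_fields s smooth_on_const)+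
    finally show ?thesis
      using dirD_metric_fields[OF x s smooth_on_const, of a w z b]
        dirD_metric_fields[OF x smooth_on_const s, of w a z b] by simp
  qed
  from this[of u v] this[of v u] dirD_commute[OF open_U x smooth_metric[of w z], of u v]
  show ?thesis
    unfolding riemann4_def sym[OF x, of "R x u v z" w]
    by (simp add: riemann_eq_nabla[OF x] linear_diff[OF linear_left[OF x]] linear_diff[OF linear_right[OF x]])
qed

section \<open>Covariant 4-tensors and their covariant derivative\<close>

definition smooth_tensor4 :: "('e \<Rightarrow> 'e \<Rightarrow> 'e \<Rightarrow> 'e \<Rightarrow> 'e \<Rightarrow> real) \<Rightarrow> bool" where
  "smooth_tensor4 T \<longleftrightarrow> (\<forall>u v w z. smooth_on U (\<lambda>x. T x u v w z)) \<and>
     (\<forall>x\<in>U. \<forall>u v w z. linear (\<lambda>u. T x u v w z) \<and> linear (\<lambda>v. T x u v w z) \<and>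
        linear (\<lambda>w. T x u v w z) \<and> linear (\<lambda>z. T x u v w z))"

lemma smooth_tensor4D:
  assumes "smooth_tensor4 T"
  shows "smooth_on U (\<lambda>x. T x u v w z)"
    "x \<in> U \<Longrightarrow> linear (\<lambda>u. T x u v w z)" "x \<in> U \<Longrightarrow> linear (\<lambda>v. T x u v w z)"
    "x \<in> U \<Longrightarrow> linear (\<lambda>w. T x u v w z)" "x \<in> U \<Longrightarrow> linear (\<lambda>z. T x u v w z)"
  using assms unfolding smooth_tensor4_def by blast+

lemma smooth_tensor4_riemann: "smooth_tensor4 (riemann4 h)"
  unfolding smooth_tensor4_def riemann4_def
  by (auto intro!: smooth_inner_fields smooth_riemann smooth_on_const linear_right
      linear_o[OF linear_left] linear_riemann)

lemma linear_nabla4: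
  assumes T: "smooth_tensor4 T" and x: "x \<in> U"
  shows "linear (\<lambda>s. nabla4 h T x s u v w z)" "linear (\<lambda>u. nabla4 h T x s u v w z)"
    "linear (\<lambda>v. nabla4 h T x s u v w z)" "linear (\<lambda>w. nabla4 h T x s u v w z)"
    "linear (\<lambda>z. nabla4 h T x s u v w z)"
proof -
  note t = smooth_tensor4D[OF T]
  note l = t(2-5)[OF x] linear_o[OF t(2)[OF x]] linear_o[OF t(3)[OF x]] linear_o[OF t(4)[OF x]]
    linear_o[OF t(5)[OF x]] linear_christoffel[OF x] linear_christoffel'[OF x]
  have d: "linear (\<lambda>s. dirD (\<lambda>y. T y u v w z) x s)"
    "linear (\<lambda>u. dirD (\<lambda>y. T y u v w z) x s)" "linear (\<lambda>v. dirD (\<lambda>y. T y u v w z) x s)"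
    "linear (\<lambda>w. dirD (\<lambda>y. T y u v w z) x s)" "linear (\<lambda>z. dirD (\<lambda>y. T y u v w z) x s)"
    using linear_dirD[OF smooth_on_differentiable[OF t(1) x]]
      linear_dirD_param[OF open_U x, of "\<lambda>y u. T y u v w z"]
      linear_dirD_param[OF open_U x, of "\<lambda>y v. T y u v w z"]
      linear_dirD_param[OF open_U x, of "\<lambda>y w. T y u v w z"]
      linear_dirD_param[OF open_U x, of "\<lambda>y z. T y u v w z"] by (simp_all add: t)
  show "linear (\<lambda>s. nabla4 h T x s u v w z)" "linear (\<lambda>u. nabla4 h T x s u v w z)"
    "linear (\<lambda>v. nabla4 h T x s u v w z)" "linear (\<lambda>w. nabla4 h T x s u v w z)"
    "linear (\<lambda>z. nabla4 h T x s u v w z)"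
    unfolding nabla4_def by (intro linear_compose_sub d l)+
qed

text \<open>Exchanging two slots also exchanges their two Christoffel terms, so a skew symmetry
  passes to the covariant derivative.\<close>

lemma nabla4_riemann_skew:
  assumes x: "x \<in> U"
  shows "nabla4 h (riemann4 h) x s u v w z = - nabla4 h (riemann4 h) x s v u w z"
    "nabla4 h (riemann4 h) x s u v w z = - nabla4 h (riemann4 h) x s u v z w"
proof -
  have neg: "dirD (\<lambda>y. - riemann4 h y u v w z) x s = - dirD (\<lambda>y. riemann4 h y u v w z) x s" for u v w z
    by (rule dirD_linear_o[OF bounded_linear_minus[OF bounded_linear_ident]])
       (rule smooth_on_differentiable[OF smooth_tensor4D(1)[OF smooth_tensor4_riemann] x])
  have left: "riemann4 h y u v w z = - riemann4 h y v u w z" if "y \<in> U" for y u v w z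
    unfolding riemann4_def
    by (subst riemann_skew[OF that]) (rule linear_neg[OF linear_left[OF that]])
  have l: "dirD (\<lambda>y. riemann4 h y u v w z) x s = dirD (\<lambda>y. - riemann4 h y v u w z) x s"
    by (rule dirD_cong[OF open_U x left])
  have r: "dirD (\<lambda>y. riemann4 h y u v w z) x s = dirD (\<lambda>y. - riemann4 h y u v z w) x s"
    by (rule dirD_cong[OF open_U x riemann4_skew_right])
  show "nabla4 h (riemann4 h) x s u v w z = - nabla4 h (riemann4 h) x s v u w z"
    unfolding nabla4_def
    using l neg[of v u w z]
      left[OF x, of "\<Gamma> x s u" v] left[OF x, of u "\<Gamma> x s v"] left[OF x, of u v] by simp
  show "nabla4 h (riemann4 h) x s u v w z = - nabla4 h (riemann4 h) x s u v z w"
    unfolding nabla4_def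
    using r neg[of u v z w]
      riemann4_skew_right[OF x, of _ _ w z] riemann4_skew_right[OF x, of u v "\<Gamma> x s w" z]
      riemann4_skew_right[OF x, of u v w "\<Gamma> x s z"] by simp
qed

subsection \<open>The Bianchi identities\<close>

text \<open>The covariant derivative of the curvature with its last index raised. In this form it is
  built from operators on vector fields, as the Jacobi identity requires.\<close>

definition nablaR :: "'e \<Rightarrow> 'e \<Rightarrow> 'e \<Rightarrow> 'e \<Rightarrow> 'e \<Rightarrow> 'e" where
  "nablaR x s u v w = N s (\<lambda>y. R y u v w) x - R x (\<Gamma> x s u) v w - R x u (\<Gamma> x s v) w - R x u v (\<Gamma> x s w)"

lemma nabla4_riemann: 
  assumes x: "x \<in> U"
  shows "nabla4 h (riemann4 h) x s u v w z = h x (nablaR x s u v w) z"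
  unfolding nabla4_def riemann4_def dirD_metric_fields[OF x smooth_riemann smooth_on_const] nablaR_def
  by (simp add: linear_diff[OF linear_left[OF x]] nabla_def[of _ _ "\<lambda>_. z"])

text \<open>The Jacobi identity for the operators \<open>N s\<close>, \<open>N u\<close>, \<open>N v\<close>; the terms with Christoffel symbols
  in the first two slots of \<open>R\<close> cancel because the connection is torsion free.\<close>

lemma second_bianchi:
  assumes x: "x \<in> U"
  shows "nablaR x s u v w + nablaR x u v s w + nablaR x v s u w = 0"
proof -
  let ?W = "\<lambda>_::'e. w"
  have sW: "smooth_on U (N a (N b ?W))" "smooth_on U (N a ?W)" for a b
    by (intro smooth_nabla smooth_on_const)+
  have *: "nablaR x a b c w
      = N a (N c (N b ?W)) x - N a (N b (N c ?W)) x - N c (N b (N a ?W)) x + N b (N c (N a ?W)) x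
        - R x (\<Gamma> x a b) c w - R x b (\<Gamma> x a c) w" for a b c
  proof -
    have "N a (\<lambda>y. R y b c w) x = N a (\<lambda>y. N c (N b ?W) y - N b (N c ?W) y) x"
      by (rule nabla_cong[OF x]) (rule riemann_eq_nabla)
    also have "\<dots> = N a (N c (N b ?W)) x - N a (N b (N c ?W)) x"
      by (rule nabla_diff[OF x]) (rule sW)+
    \<comment> \<open>The field \<open>N a ?W\<close> has the value \<open>\<Gamma> x a w\<close> at
      \<open>x\<close>, so the Ricci identity for it turns the Christoffel term of the third slot
      into third covariant derivatives.\<close>
    finally show ?thesis
      using nabla_commutator[OF x sW(2), of c b a, symmetric]
      by (simp add: nablaR_def nabla_def[of _ _ "?W"])
  qed
  show ?thesis
    unfolding *
    by (simp add: christoffel_sym[OF x, of s u] christoffel_sym[OF x, of s v] christoffel_sym[OF x, of u v]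
       riemann_skew[OF x, of _ "\<Gamma> x _ _"])
qed

subsection \<open>Traces\<close>

text \<open>Differentiate the constant \<open>c \<bullet> b\<close>, written as
  \<open>h y (dual b y) c\<close>: the dual basis moves by minus the transpose of the Christoffel
  matrix.\<close>

lemma nabla_dual:
  assumes x: "x \<in> U"
  shows "N v (dual b) x = - (\<Sum>c\<in>Basis. (\<Gamma> x v c \<bullet> b) *\<^sub>R dual c x)"
proof -
  have "h x (N v (dual b) x) c = - (\<Gamma> x v c \<bullet> b)" for c
  proof -
    have "dirD (\<lambda>y. h y (dual b y) c) x v = dirD (\<lambda>y. c \<bullet> b) x v"
      by (rule dirD_cong[OF open_U x metric_dual])
    then show ?thesis
      using dirD_metric_fields[OF x smooth_dual smooth_on_const, of b c v]
      by (simp add: nabla_def[of _ _ "\<lambda>_. c"] metric_dual[OF x])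
  qed
  then show ?thesis
    by (subst dual_expand[OF x]) (simp add: sum_negf)
qed

text \<open>Traces commute with covariant differentiation. The vectors \<open>b\<close> are constant
  while \<open>dual b\<close> moves; by \<open>nabla_dual\<close> this motion is exactly the
  Christoffel correction in the other slot.\<close>

lemma dirD_trace:
  fixes T :: "'e \<Rightarrow> 'e \<Rightarrow> 'e \<Rightarrow> real"
  assumes x: "x \<in> U" and T: "\<And>y v. y \<in> U \<Longrightarrow> linear (\<lambda>u. T y u v)" "\<And>y u. y \<in> U \<Longrightarrow> linear (T y u)"
    and s: "\<And>u v. smooth_on U (\<lambda>y. T y u v)"
  shows "dirD (\<lambda>y. \<Sum>b\<in>Basis. T y (dual b y) b) x v = (\<Sum>b\<in>Basis.
    dirD (\<lambda>y. T y (dual b x) b) x v - T x (\<Gamma> x v (dual b x)) b - T x (dual b x) (\<Gamma> x v b))"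
proof -
  have sd: "smooth_on U (\<lambda>y. T y (dual b y) c)" for b c
    by (rule smooth_on_linear_field[OF open_U, of "\<lambda>y u. T y u c"]) (auto intro: T s smooth_dual)
  have "dirD (\<lambda>y. \<Sum>b\<in>Basis. T y (dual b y) b) x v = (\<Sum>b\<in>Basis. dirD (\<lambda>y. T y (dual b y) b) x v)"
    by (rule dirD_sum) (rule smooth_on_differentiable[OF sd x])
  also have "\<dots> = (\<Sum>b\<in>Basis. dirD (\<lambda>y. T y (dual b x) b) x v - T x (\<Gamma> x v (dual b x)) b + T x (N v (dual b) x) b)"
  proof (rule sum.cong[OF refl])
    fix b
    have "dirD (\<lambda>y. T y (dual b y) b) x v = dirD (\<lambda>y. T y (dual b x) b) x v + T x (dirD (dual b) x v) b"
      by (rule dirD_linear_field[OF open_U x, of "\<lambda>y u. T y u b"]) (auto intro: T s smooth_dual)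
    then show "dirD (\<lambda>y. T y (dual b y) b) x v
        = dirD (\<lambda>y. T y (dual b x) b) x v - T x (\<Gamma> x v (dual b x)) b + T x (N v (dual b) x) b"
      by (simp add: nabla_def linear_add[OF T(1)[OF x]])
  qed
  also have "\<dots> = (\<Sum>b\<in>Basis. dirD (\<lambda>y. T y (dual b x) b) x v - T x (\<Gamma> x v (dual b x)) b)
      + (\<Sum>b\<in>Basis. T x (N v (dual b) x) b)"
    by (simp add: sum.distrib)
  also have "(\<Sum>b\<in>Basis. T x (N v (dual b) x) b) = - (\<Sum>b\<in>Basis. T x (dual b x) (\<Gamma> x v b))"
  proof -
    have "(\<Sum>b\<in>Basis. T x (N v (dual b) x) b) = - (\<Sum>b\<in>Basis. \<Sum>c\<in>Basis. (\<Gamma> x v c \<bullet> b) * T x (dual c x) b)"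
      by (simp add: nabla_dual[OF x] linear_neg[OF T(1)[OF x]] linear_sum[OF T(1)[OF x]]
          linear_scale[OF T(1)[OF x]] sum_negf)
    also have "\<dots> = - (\<Sum>c\<in>Basis. \<Sum>b\<in>Basis. (\<Gamma> x v c \<bullet> b) * T x (dual c x) b)"
      by (subst sum.swap) simp
    also have "\<dots> = - (\<Sum>c\<in>Basis. T x (dual c x) (\<Gamma> x v c))"
      by (subst (2) linear_Basis_expand[OF T(2)[OF x]]) simp
    finally show ?thesis .
  qed
  finally show ?thesis by (simp add: sum_subtractf)
qed

lemma smooth_trace:
  fixes T :: "'e \<Rightarrow> 'e \<Rightarrow> 'e \<Rightarrow> real"
  assumes T: "\<And>y v. y \<in> U \<Longrightarrow> linear (\<lambda>u. T y u v)" and s: "\<And>u v. smooth_on U (\<lambda>y. T y u v)"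
  shows "smooth_on U (\<lambda>y. \<Sum>b\<in>Basis. T y (dual b y) b)"
  by (rule smooth_on_sum[OF open_U], rule smooth_on_linear_field[OF open_U _ _ smooth_dual]) (auto intro: T s)

section \<open>Ricci tensor, scalar curvature and the contracted Bianchi identity\<close>

lemma ricci_trace: "x \<in> U \<Longrightarrow> ricci h x u w = (\<Sum>c\<in>Basis. riemann4 h x u c w (dual c x))"
  by (simp add: ricci_def riemann4_def metric_dual')

lemma scalar_curvature_trace: "scalar_curvature h x = (\<Sum>b\<in>Basis. ricci h x (dual b x) b)"
  by (simp add: scalar_curvature_def dual_def)

lemma linear_ricci:
  assumes x: "x \<in> U"
  shows "linear (\<lambda>u. ricci h x u w)" "linear (ricci h x u)"
proof -
  show "linear (\<lambda>u. ricci h x u w)" "linear (ricci h x u)"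
    unfolding ricci_trace[OF x] ricci_trace[OF x, abs_def]
    by (intro linear_compose_sum ballI smooth_tensor4D[OF smooth_tensor4_riemann] x)+
qed

lemma smooth_ricci: "smooth_on U (\<lambda>x. ricci h x u w)"
  unfolding ricci_def by (intro smooth_on_sum smooth_on_inner smooth_riemann open_U)

lemma smooth_scalar_curvature: "smooth_on U (scalar_curvature h)"
  using smooth_trace[of "ricci h"] linear_ricci smooth_ricci
  by (simp add: scalar_curvature_trace[abs_def])

text \<open>The covariant derivative of the Ricci tensor is the trace of that of the curvature. The
  two Christoffel terms are those that \<open>dirD_trace\<close> subtracts, so they cancel in the
  scalar curvature.\<close>

lemma dirD_ricci:
  assumes x: "x \<in> U"
  shows "dirD (\<lambda>y. ricci h y u w) x v = ricci h x (\<Gamma> x v u) w + ricci h x u (\<Gamma> x v w)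
    + (\<Sum>c\<in>Basis. nabla4 h (riemann4 h) x v u c w (dual c x))"
proof -
  note t = smooth_tensor4D[OF smooth_tensor4_riemann]
  have "dirD (\<lambda>y. ricci h y u w) x v = dirD (\<lambda>y. \<Sum>c\<in>Basis. riemann4 h y u c w (dual c y)) x v"
    by (rule dirD_cong[OF open_U x ricci_trace])
  also have "\<dots> = (\<Sum>c\<in>Basis. dirD (\<lambda>y. riemann4 h y u c w (dual c x)) x v
      - riemann4 h x u c w (\<Gamma> x v (dual c x)) - riemann4 h x u (\<Gamma> x v c) w (dual c x))"
    by (rule dirD_trace[OF x, of "\<lambda>y z c. riemann4 h y u c w z"]) (auto intro: t)
  also have "\<dots> = (\<Sum>c\<in>Basis. nabla4 h (riemann4 h) x v u c w (dual c x)
      + riemann4 h x (\<Gamma> x v u) c w (dual c x) + riemann4 h x u c (\<Gamma> x v w) (dual c x))"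
    by (rule sum.cong) (simp_all add: nabla4_def)
  finally show ?thesis by (simp add: sum.distrib ricci_trace[OF x])
qed

lemma dirD_scalar_curvature:
  assumes x: "x \<in> U"
  shows "dirD (scalar_curvature h) x v
    = (\<Sum>b\<in>Basis. \<Sum>c\<in>Basis. nabla4 h (riemann4 h) x v (dual b x) c b (dual c x))"
  unfolding scalar_curvature_trace[abs_def]
  by (subst dirD_trace[OF x]) (auto intro: linear_ricci smooth_ricci simp: dirD_ricci[OF x])

text \<open>Tracing the second Bianchi identity twice turns one cyclic term into the derivative of
  the scalar curvature and each of the other two into the same traced divergence; hence the factor
  2.\<close>

lemma contracted_bianchi:
  assumes x: "x \<in> U"
  shows "dirD (scalar_curvature h) x v
    = 2 * (\<Sum>b\<in>Basis. divergence4 h (riemann4 h) x (dual b x) v b)"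
proof -
  let ?B = "nabla4 h (riemann4 h) x"
  note l = linear_nabla4[OF smooth_tensor4_riemann x]
  \<comment> \<open>The skew symmetries are used so that, after tracing, both terms contract the
    direction of differentiation with the last slot, as \<open>divergence4\<close> does.\<close>
  have bianchi: "?B v p c b q = ?B p c v q b + ?B c p v b q" for p c b q
  proof -
    have "?B v p c b q + ?B p c v b q + ?B c v p b q = 0"
      unfolding nabla4_riemann[OF x]
      using second_bianchi[OF x, of v p c b] linear_0[OF linear_left[OF x]]
      by (simp add: linear_add[OF linear_left[OF x], symmetric])
    then show ?thesis
      using nabla4_riemann_skew(2)[OF x, of p c v b q] nabla4_riemann_skew(1)[OF x, of c v p b q] by simp
  qed
  have "(\<Sum>b\<in>Basis. \<Sum>c\<in>Basis. ?B (dual b x) c v (dual c x) b)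
      = (\<Sum>b\<in>Basis. \<Sum>c\<in>Basis. ?B (dual b x) (dual c x) v c b)"
    by (rule sum.cong[OF refl], rule trace_swap[OF x, symmetric]) (rule l)+
  also have "\<dots> = (\<Sum>c\<in>Basis. divergence4 h (riemann4 h) x (dual c x) v c)"
    unfolding divergence4_def dual_def[symmetric] by (rule sum.swap)
  finally have 1: "(\<Sum>b\<in>Basis. \<Sum>c\<in>Basis. ?B (dual b x) c v (dual c x) b) = \<dots>" .
  have 2: "(\<Sum>b\<in>Basis. \<Sum>c\<in>Basis. ?B c (dual b x) v b (dual c x))
      = (\<Sum>b\<in>Basis. divergence4 h (riemann4 h) x (dual b x) v b)"
    unfolding divergence4_def dual_def[symmetric]
    by (rule sum.cong[OF refl], rule trace_swap[OF x, symmetric]) (rule l)+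
  show ?thesis
    unfolding dirD_scalar_curvature[OF x] bianchi sum.distrib 1 2 by simp
qed

subsection \<open>Divergence of the concircular curvature tensor\<close>

text \<open>The metric is parallel, so in the correction term only the scalar curvature is
  differentiated.\<close>

lemma nabla4_concircular:
  fixes k :: real
  assumes x: "x \<in> U"
  defines "k \<equiv> real DIM('e) * (real DIM('e) - 1)"
  shows "nabla4 h (concircular h) x s u v w z = nabla4 h (riemann4 h) x s u v w z
    - dirD (scalar_curvature h) x s / k * (h x u w * h x v z - h x v w * h x u z)"
proof -
  let ?\<tau> = "scalar_curvature h" and ?G = "\<lambda>y u v w z. h y u w * h y v z - h y v w * h y u z"
  have dR: "(\<lambda>y. riemann4 h y u v w z) differentiable (at x)"
    by (rule smooth_on_differentiable[OF smooth_tensor4D(1)[OF smooth_tensor4_riemann] x])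
  have dt: "?\<tau> differentiable (at x)"
    by (rule smooth_on_differentiable[OF smooth_scalar_curvature x])
  have Dh: "dirD (\<lambda>y. h y a b) x s = h x (\<Gamma> x s a) b + h x a (\<Gamma> x s b)" for a b
    using dirD_metric_fields[OF x smooth_on_const smooth_on_const, of a b s] by (simp add: nabla_def)
  note dh = diff_metric[OF x]
  have dG: "(\<lambda>y. ?G y u v w z) differentiable (at x)"
    by (intro differentiable_diff differentiable_mult dh)
  have DG: "dirD (\<lambda>y. ?G y u v w z) x s = ?G x (\<Gamma> x s u) v w z + ?G x u (\<Gamma> x s v) w z
      + ?G x u v (\<Gamma> x s w) z + ?G x u v w (\<Gamma> x s z)"
    by (simp add: dirD_diff dirD_mult dh differentiable_mult Dh algebra_simps)
  have "dirD (\<lambda>y. concircular h y u v w z) x s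
      = dirD (\<lambda>y. riemann4 h y u v w z - (1 / k) *\<^sub>R (?\<tau> y * ?G y u v w z)) x s"
    by (simp add: concircular_def k_def mult.assoc)
  also have "\<dots> = dirD (\<lambda>y. riemann4 h y u v w z) x s
      - (1 / k) *\<^sub>R (?\<tau> x * dirD (\<lambda>y. ?G y u v w z) x s + dirD ?\<tau> x s * ?G x u v w z)"
    by (subst dirD_diff[OF dR], (intro differentiable_scaleR differentiable_const differentiable_mult dt dG),
        subst dirD_linear_o[OF bounded_linear_scaleR_right], (intro differentiable_mult dt dG),
        subst dirD_mult[OF dt dG]) (rule refl)
  finally have D: "dirD (\<lambda>y. concircular h y u v w z) x s = \<dots>" .
  have C: "concircular h x u v w z = riemann4 h x u v w z - ?\<tau> x / k * ?G x u v w z" for u v w z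
    by (simp add: concircular_def k_def)
  show ?thesis
    unfolding nabla4_def D C DG by (simp add: algebra_simps diff_divide_distrib add_divide_distrib)
qed

lemma divergence_concircular:
  fixes k :: real
  assumes x: "x \<in> U"
  defines "k \<equiv> real DIM('e) * (real DIM('e) - 1)"
  shows "divergence4 h (concircular h) x u v w = divergence4 h (riemann4 h) x u v w
    - (h x u w * dirD (scalar_curvature h) x v - h x v w * dirD (scalar_curvature h) x u) / k"
proof -
  let ?t = "dirD (scalar_curvature h) x"
  have lin: "linear ?t"
    by (rule linear_dirD[OF smooth_on_differentiable[OF smooth_scalar_curvature x]])
  \<comment> \<open>Contracting the differential with \<open>h x a\<close> returns its value at
    \<open>a\<close>, by the expansion of \<open>a\<close> in the dual basis.\<close>
  have t: "?t a = (\<Sum>b\<in>Basis. ?t (dual b x) * h x a b)" for a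
    by (subst dual_expand[OF x, of a]) (simp add: linear_sum[OF lin] linear_scale[OF lin] mult.commute)
  have "divergence4 h (concircular h) x u v w = divergence4 h (riemann4 h) x u v w
      - (\<Sum>b\<in>Basis. ?t (dual b x) / k * (h x u w * h x v b - h x v w * h x u b))"
    unfolding divergence4_def nabla4_concircular[OF x] dual_def[symmetric] k_def
    by (simp add: sum_subtractf)
  also have "(\<Sum>b\<in>Basis. ?t (dual b x) / k * (h x u w * h x v b - h x v w * h x u b))
      = (\<Sum>b\<in>Basis. h x u w / k * (?t (dual b x) * h x v b) - h x v w / k * (?t (dual b x) * h x u b))"
    by (rule sum.cong) (simp_all add: algebra_simps)
  also have "\<dots> = (h x u w * ?t v - h x v w * ?t u) / k"
    unfolding sum_subtractf sum_distrib_left[symmetric] t[symmetric] by (simp add: diff_divide_distrib)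
  finally show ?thesis .
qed

lemma scalar_curvature_stationary:
  assumes x: "x \<in> U" and n: "DIM('e) \<ge> 3"
    and div: "\<And>u v w. divergence4 h (concircular h) x u v w = 0"
  shows "dirD (scalar_curvature h) x v = 0"
proof -
  let ?t = "dirD (scalar_curvature h) x" and ?n = "real DIM('e)"
  have lin: "linear ?t"
    by (rule linear_dirD[OF smooth_on_differentiable[OF smooth_scalar_curvature x]])
  have 1: "divergence4 h (riemann4 h) x u v w = (h x u w * ?t v - h x v w * ?t u) / (?n * (?n - 1))" for u v w
    using divergence_concircular[OF x, of u v w] div by simp
  have tr: "(\<Sum>b\<in>Basis. h x (dual b x) b) = ?n"
    by (simp add: metric_dual[OF x])
  have t: "(\<Sum>b\<in>Basis. h x v b * ?t (dual b x)) = ?t v"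
    by (subst (2) dual_expand[OF x, of v]) (simp add: linear_sum[OF lin] linear_scale[OF lin])
  have "?t v = 2 * (\<Sum>b\<in>Basis. (h x (dual b x) b * ?t v - h x v b * ?t (dual b x)) / (?n * (?n - 1)))"
    using contracted_bianchi[OF x, of v] unfolding 1 .
  \<comment> \<open>The trace of the metric is \<open>?n\<close> and the other term contributes one
    \<open>?t v\<close>, so a factor \<open>?n - 1\<close> appears and cancels the one in the
    denominator.\<close>
  also have "\<dots> = 2 * ((?n * ?t v - ?t v) / (?n * (?n - 1)))"
    unfolding sum_divide_distrib[symmetric] sum_subtractf sum_distrib_right[symmetric] tr t ..
  also have "\<dots> = 2 / ?n * ?t v"
    using n by (simp add: field_simps)
  finally have "(1 - 2 / ?n) * ?t v = 0" by (simp add: algebra_simps)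
  moreover have "1 - 2 / ?n \<noteq> 0" using n by (simp add: field_simps)
  ultimately show ?thesis by simp
qed

end

section \<open>Static metrics in a chart\<close>

definition warped_metric :: "'e::euclidean_space local_metric \<Rightarrow> ('e \<Rightarrow> real) \<Rightarrow> (real \<times> 'e) local_metric" where
  "warped_metric h F = (\<lambda>(t, x) (a, u) (b, v). - (F x)\<^sup>2 * a * b + h x u v)"

lemma warped_metric_apply:
  "warped_metric h F (t, x) (a, u) (b, v) = - (F x)\<^sup>2 * a * b + h x u v"
  by (simp add: warped_metric_def)

lemma dirD_snd:
  assumes "K differentiable (at x)"
  shows "dirD (\<lambda>p. K (snd p)) (t, x) V = dirD K x (snd V)"
proof (rule dirD_eqI)
  show "((\<lambda>p. K (snd p)) has_derivative (\<lambda>V. dirD K x (snd V))) (at (t, x))"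
    using has_derivative_compose[OF has_derivative_snd[OF has_derivative_ident], of K "dirD K x" "(t, x)" UNIV]
      has_dirD[OF assms] by simp
qed

lemma sum_Basis_real_prod:
  fixes f :: "real \<times> 'e::euclidean_space \<Rightarrow> 'c::comm_monoid_add"
  shows "(\<Sum>i\<in>Basis. f i) = f (1, 0) + (\<Sum>b\<in>Basis. f (0, b))"
  unfolding Basis_prod_def
  by (subst sum.union_disjoint) (auto simp: sum.reindex inj_on_def)

text \<open>The metric locale is imported twice, so every result on connection and curvature is
  available for \<open>h\<close> and, with the prefix \<open>total\<close>, for the space-time
  metric.\<close>

locale static_chart =
  coordinate_metric U h + total: coordinate_metric "J \<times> U" "warped_metric h F"
  for U :: "'e::euclidean_space set" and h :: "'e local_metric" and J :: "real set" and F :: "'e \<Rightarrow> real" +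
  assumes smooth_F: "smooth_on U F"
    and F_pos: "x \<in> U \<Longrightarrow> F x > 0"
    and hessian_F: "x \<in> U \<Longrightarrow> hessian h F x u v = 0"
begin

abbreviation H :: "(real \<times> 'e) local_metric" where "H \<equiv> warped_metric h F"

abbreviation dF :: "'e \<Rightarrow> 'e \<Rightarrow> real" where "dF \<equiv> dirD F"

definition grad :: "'e \<Rightarrow> 'e" where "grad x = sharp h x (dF x)"

lemma diff_F: "x \<in> U \<Longrightarrow> F differentiable (at x)"
  by (rule smooth_on_differentiable[OF smooth_F])

lemma linear_dF: "x \<in> U \<Longrightarrow> linear (dF x)"
  by (rule linear_dirD[OF diff_F])

lemma metric_grad: "x \<in> U \<Longrightarrow> h x (grad x) w = dF x w"
  unfolding grad_def by (rule metric_sharp[OF _ linear_dF])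

lemma smooth_grad: "smooth_on U grad"
proof (rule smooth_on_cong[OF open_U])
  show "(\<Sum>b\<in>Basis. dF x b *\<^sub>R dual b x) = grad x" if "x \<in> U" for x
    using dual_expand[OF that, of "grad x"] metric_grad[OF that] by simp
qed (intro smooth_on_sum smooth_on_scaleR smooth_on_dirD open_U smooth_dual smooth_F)

text \<open>The Hessian hypothesis enters the chart computations here: second derivatives of
  \<open>F\<close> become first derivatives along a Christoffel vector.\<close>

lemma dirD_dF: "x \<in> U \<Longrightarrow> dirD (\<lambda>y. dF y w) x v = dF x (\<Gamma> x v w)"
  using hessian_F[of x v w] by (simp add: hessian_def)

lemma nabla_grad:
  assumes x: "x \<in> U" shows "N v grad x = 0"
proof (rule nondeg[OF x])
  fix w
  have "dirD (\<lambda>y. h y (grad y) w) x v = dirD (\<lambda>y. dF y w) x v"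
    by (rule dirD_cong[OF open_U x metric_grad])
  then show "h x (N v grad x) w = 0"
    using dirD_metric_fields[OF x smooth_grad smooth_on_const, of w v]
    by (simp add: nabla_def[of _ _ "\<lambda>_. w"] metric_grad[OF x] dirD_dF[OF x])
qed

lemma dirD_grad: "x \<in> U \<Longrightarrow> dirD grad x v = - \<Gamma> x v (grad x)"
  using nabla_grad[of x v] by (simp add: nabla_def eq_neg_iff_add_eq_0)

text \<open>A parallel field is annihilated by the curvature, by the Ricci identity; skew symmetry
  then moves \<open>grad x\<close> from the third slot to the fourth, where the divergence on the
  product needs it.\<close>

lemma riemann4_grad:
  assumes x: "x \<in> U" shows "riemann4 h x u v w (grad x) = 0"
proof -
  have "N b (N a grad) x = N b (\<lambda>_. 0) x" for a b
    by (rule nabla_cong[OF x nabla_grad])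
  then have "R x u v (grad x) = 0"
    using nabla_commutator[OF x smooth_grad, of v u]
    by (simp add: nabla_def[of _ _ "\<lambda>_. 0"] linear_0[OF linear_christoffel[OF x]])
  then show ?thesis
    using riemann4_skew_right[OF x, of u v w "grad x"] linear_0[OF linear_left[OF x]]
    by (simp add: riemann4_def)
qed

section \<open>Connection and curvature of the static metric\<close>

lemma dirD_warped_metric:
  assumes x: "x \<in> U"
  shows "dirD (\<lambda>p. H p (b, v) (c, w)) (t, x) (a, u) = - 2 * F x * dF x u * b * c + dirD (\<lambda>y. h y v w) x u"
proof -
  have e: "(\<lambda>p. H p (b, v) (c, w)) = (\<lambda>p. (- (b * c)) * (F (snd p) * F (snd p)) + h (snd p) v w)"
    by (auto simp: warped_metric_def power2_eq_square)
  note dF' = diff_F[OF x] and dh = diff_metric[OF x]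
  have d2: "(\<lambda>y. F y * F y) differentiable (at x)"
    and dK: "(\<lambda>y. (- (b * c)) * (F y * F y)) differentiable (at x)"
    by (intro differentiable_mult differentiable_const dF')+
  show ?thesis
    unfolding e dirD_snd[of "\<lambda>y. (- (b * c)) * (F y * F y) + h y v w", OF differentiable_add[OF dK dh]]
      dirD_add[OF dK dh] dirD_mult[OF differentiable_const d2] dirD_mult[OF dF' dF']
    by (simp add: algebra_simps)
qed

text \<open>The only new symbols are \<open>F x *\<^sub>R grad x\<close> for two time arguments and
  \<open>dF x u / F x\<close> for a mixed pair. The candidate is verified by pairing it with an
  arbitrary vector and comparing with \<open>koszul\<close>.\<close>

lemma christoffel_warped:
  assumes t: "t \<in> J" and x: "x \<in> U"
  shows "christoffel H (t, x) (a, u) (b, v)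
    = ((a * dF x v + b * dF x u) / F x, \<Gamma> x u v + (a * b * F x) *\<^sub>R grad x)"
proof (rule total.metric_eqI)
  show p: "(t, x) \<in> J \<times> U" using t x by simp
  fix W :: "real \<times> 'e"
  obtain c w where W: "W = (c, w)" by (cases W)
  have "H (t, x) ((a * dF x v + b * dF x u) / F x, \<Gamma> x u v + (a * b * F x) *\<^sub>R grad x) (c, w)
      = - F x * (a * dF x v + b * dF x u) * c + koszul x u v w + a * b * F x * dF x w"
    using F_pos[OF x]
    by (simp add: warped_metric_apply linear_add[OF linear_left[OF x]] linear_scale[OF linear_left[OF x]]
        metric_christoffel[OF x] metric_grad[OF x] power2_eq_square)
  then show "H (t, x) (christoffel H (t, x) (a, u) (b, v)) W
      = H (t, x) ((a * dF x v + b * dF x u) / F x, \<Gamma> x u v + (a * b * F x) *\<^sub>R grad x) W"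
    unfolding W total.metric_christoffel[OF p] total.koszul_def dirD_warped_metric[OF x] koszul_def
    by (simp add: field_simps)
qed

lemma dirD_christoffel_warped:
  assumes t: "t \<in> J" and x: "x \<in> U"
  shows "dirD (\<lambda>p. christoffel H p (a, u) (c, w)) (t, x) (b, v)
    = (((a * dF x (\<Gamma> x v w) + c * dF x (\<Gamma> x v u)) * F x - (a * dF x w + c * dF x u) * dF x v) / (F x * F x),
       dirD (\<lambda>y. \<Gamma> y u w) x v - (a * c * F x) *\<^sub>R \<Gamma> x v (grad x) + (a * c * dF x v) *\<^sub>R grad x)"
proof -
  let ?P = "\<lambda>y. ((a * dF y w + c * dF y u) / F y, \<Gamma> y u w + (a * c * F y) *\<^sub>R grad y)"
  have dd: "((\<lambda>y. dF y w) has_derivative (\<lambda>v. dF x (\<Gamma> x v w))) (at x)" for w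
    using has_dirD[OF smooth_on_differentiable[OF smooth_on_dirD[OF smooth_F] x], of w] dirD_dF[OF x]
    by simp
  have dG: "(grad has_derivative (\<lambda>v. - \<Gamma> x v (grad x))) (at x)"
    using has_dirD[OF smooth_on_differentiable[OF smooth_grad x]] dirD_grad[OF x] by simp
  have dC: "((\<lambda>y. \<Gamma> y u w) has_derivative dirD (\<lambda>y. \<Gamma> y u w) x) (at x)"
    by (rule has_dirD[OF smooth_on_differentiable[OF smooth_christoffel x]])
  note dF' = has_dirD[OF diff_F[OF x]]
  have num: "((\<lambda>y. a * dF y w + c * dF y u) has_derivative
      (\<lambda>v. a * dF x (\<Gamma> x v w) + c * dF x (\<Gamma> x v u))) (at x)"
    by (intro has_derivative_add has_derivative_mult_right dd)
  have F: "F x \<noteq> 0" using F_pos[OF x] by simp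
  have P: "(?P has_derivative (\<lambda>v.
      (((a * dF x (\<Gamma> x v w) + c * dF x (\<Gamma> x v u)) * F x - (a * dF x w + c * dF x u) * dF x v) / (F x * F x),
       dirD (\<lambda>y. \<Gamma> y u w) x v + ((a * c * F x) *\<^sub>R (- \<Gamma> x v (grad x)) + (a * c * dF x v) *\<^sub>R grad x)))) (at x)"
    by (intro has_derivative_Pair has_derivative_divide'[OF num dF' F] has_derivative_add dC
        has_derivative_scaleR has_derivative_mult_right dF' dG)
  then have "?P differentiable (at x)" by (auto simp: differentiable_def)
  then have "dirD (\<lambda>p. ?P (snd p)) (t, x) (b, v) = dirD ?P x v"
    by (subst dirD_snd[of ?P]) simp_all
  moreover have "dirD (\<lambda>p. christoffel H p (a, u) (c, w)) (t, x) (b, v) = dirD (\<lambda>p. ?P (snd p)) (t, x) (b, v)"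
    by (rule dirD_cong[OF total.open_U]) (use t x christoffel_warped in auto)
  ultimately show ?thesis using dirD_eqI[OF P, of v] by simp
qed

lemma riemann_warped:
  assumes t: "t \<in> J" and x: "x \<in> U"
  shows "riemann H (\<lambda>_. X) (\<lambda>_. Y) (\<lambda>_. Z) (t, x) = (0, R x (snd X) (snd Y) (snd Z))"
proof -
  obtain a u b v c w where XYZ: "X = (a, u)" "Y = (b, v)" "Z = (c, w)"
    by (cases X, cases Y, cases Z)
  have p: "(t, x) \<in> J \<times> U" using t x by simp
  have F: "F x \<noteq> 0" using F_pos[OF x] by simp
  note l = linear_add[OF linear_dF[OF x]] linear_scale[OF linear_dF[OF x]]
    linear_add[OF linear_christoffel[OF x]] linear_scale[OF linear_christoffel[OF x]]
  show ?thesis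
  proof (rule prod_eqI)
    \<comment> \<open>The quadratic terms in \<open>dF\<close> from the quotient rule cancel against
      products of Christoffel symbols; the rest cancels by the symmetry of \<open>\<Gamma>\<close>
      and because the term with \<open>a * b * c\<close> is unchanged when the first two arguments
      are exchanged.\<close>
    show "fst (riemann H (\<lambda>_. X) (\<lambda>_. Y) (\<lambda>_. Z) (t, x)) = fst (0, R x (snd X) (snd Y) (snd Z))"
      unfolding total.riemann_formula[OF p] XYZ dirD_christoffel_warped[OF t x] christoffel_warped[OF t x]
      using F by (simp add: l christoffel_sym[OF x, of u v] field_simps)
    show "snd (riemann H (\<lambda>_. X) (\<lambda>_. Y) (\<lambda>_. Z) (t, x)) = snd (0, R x (snd X) (snd Y) (snd Z))"
      unfolding total.riemann_formula[OF p] XYZ dirD_christoffel_warped[OF t x] christoffel_warped[OF t x]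
        snd_conv riemann_formula[OF x]
      using F by (simp add: l) (simp add: algebra_simps)
  qed
qed

lemma riemann4_warped:
  assumes t: "t \<in> J" and x: "x \<in> U"
  shows "riemann4 H (t, x) X Y Z W = riemann4 h x (snd X) (snd Y) (snd Z) (snd W)"
  unfolding riemann4_def riemann_warped[OF t x] by (cases W) (simp add: warped_metric_apply)

lemma dual_warped:
  assumes t: "t \<in> J" and x: "x \<in> U"
  shows "total.dual (1, 0) (t, x) = (- 1 / (F x)\<^sup>2, 0)" "total.dual (0, b) (t, x) = (0, dual b x)"
proof -
  have p: "(t, x) \<in> J \<times> U" using t x by simp
  have F: "F x \<noteq> 0" using F_pos[OF x] by simp
  have "H (t, x) (total.dual (1, 0) (t, x)) W = H (t, x) (- 1 / (F x)\<^sup>2, 0) W" for W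
    unfolding total.metric_dual[OF p]
    by (cases W) (simp add: warped_metric_apply F linear_0[OF linear_left[OF x]])
  then show "total.dual (1, 0) (t, x) = (- 1 / (F x)\<^sup>2, 0)" by (rule total.metric_eqI[OF p])
  have "H (t, x) (total.dual (0, b) (t, x)) W = H (t, x) (0, dual b x) W" for W
    unfolding total.metric_dual[OF p] by (cases W) (simp add: warped_metric_apply metric_dual[OF x])
  then show "total.dual (0, b) (t, x) = (0, dual b x)" by (rule total.metric_eqI[OF p])
qed

lemma ricci_warped:
  assumes t: "t \<in> J" and x: "x \<in> U"
  shows "ricci H (t, x) X Z = ricci h x (snd X) (snd Z)"
  unfolding ricci_def riemann_warped[OF t x] sum_Basis_real_prod by simp

lemma scalar_curvature_warped:
  assumes t: "t \<in> J" and x: "x \<in> U"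
  shows "scalar_curvature H (t, x) = scalar_curvature h x"
  unfolding total.scalar_curvature_trace scalar_curvature_trace ricci_warped[OF t x] sum_Basis_real_prod
  by (simp add: dual_warped[OF t x] linear_0[OF linear_ricci(2)[OF x]])

lemma dirD_scalar_curvature_warped:
  assumes t: "t \<in> J" and x: "x \<in> U"
  shows "dirD (scalar_curvature H) (t, x) V = dirD (scalar_curvature h) x (snd V)"
proof -
  have "dirD (scalar_curvature H) (t, x) V = dirD (\<lambda>p. scalar_curvature h (snd p)) (t, x) V"
    by (rule dirD_cong[OF total.open_U]) (use t x scalar_curvature_warped in auto)
  also have "\<dots> = dirD (scalar_curvature h) x (snd V)"
    by (rule dirD_snd[OF smooth_on_differentiable[OF smooth_scalar_curvature x]])
  finally show ?thesis .
qed

text \<open>The inverse metric is block diagonal, so the divergence needs only these two cases. In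
  the second, the last slot has spatial part 0, which kills all terms but the Christoffel correction
  of that slot; this one is a multiple of the curvature with \<open>grad x\<close> in the last
  slot.\<close>

lemma nabla4_riemann_warped:
  assumes t: "t \<in> J" and x: "x \<in> U"
  shows "nabla4 H (riemann4 H) (t, x) (0, s) X Y Z (0, z)
      = nabla4 h (riemann4 h) x s (snd X) (snd Y) (snd Z) z"
    and "nabla4 H (riemann4 H) (t, x) (\<sigma>, 0) X Y Z (1, 0) = 0"
proof -
  note T = smooth_tensor4D[OF smooth_tensor4_riemann]
  have D: "dirD (\<lambda>p. riemann4 H p X Y Z W) (t, x) V
      = dirD (\<lambda>y. riemann4 h y (snd X) (snd Y) (snd Z) (snd W)) x (snd V)" for W V
  proof -
    have "dirD (\<lambda>p. riemann4 H p X Y Z W) (t, x) V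
        = dirD (\<lambda>p. riemann4 h (snd p) (snd X) (snd Y) (snd Z) (snd W)) (t, x) V"
      by (rule dirD_cong[OF total.open_U]) (use t x in \<open>auto simp: riemann4_warped\<close>)
    also have "\<dots> = dirD (\<lambda>y. riemann4 h y (snd X) (snd Y) (snd Z) (snd W)) x (snd V)"
      by (rule dirD_snd[OF smooth_on_differentiable[OF T(1) x]])
    finally show ?thesis .
  qed
  have C: "snd (christoffel H (t, x) (0, s) V) = \<Gamma> x s (snd V)" for s V
    by (cases V) (simp add: christoffel_warped[OF t x])
  show "nabla4 H (riemann4 H) (t, x) (0, s) X Y Z (0, z)
      = nabla4 h (riemann4 h) x s (snd X) (snd Y) (snd Z) z"
    unfolding nabla4_def D riemann4_warped[OF t x] C by simp
  show "nabla4 H (riemann4 H) (t, x) (\<sigma>, 0) X Y Z (1, 0) = 0"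
    unfolding nabla4_def D riemann4_warped[OF t x] christoffel_warped[OF t x]
    by (simp add: linear_0[OF T(5)[OF x]] linear_scale[OF T(5)[OF x]] riemann4_grad[OF x]
        linear_0[OF linear_christoffel[OF x]] linear_0[OF linear_dirD[OF smooth_on_differentiable[OF T(1) x]]])
qed

lemma divergence_riemann_warped:
  assumes t: "t \<in> J" and x: "x \<in> U"
  shows "divergence4 H (riemann4 H) (t, x) X Y Z = divergence4 h (riemann4 h) x (snd X) (snd Y) (snd Z)"
  unfolding divergence4_def total.dual_def[symmetric] dual_def[symmetric] sum_Basis_real_prod
  by (simp add: dual_warped[OF t x] nabla4_riemann_warped[OF t x])

text \<open>Here \<open>k\<close> is \<open>m (m - 1)\<close> for the dimension
  \<open>m = DIM('e) + 1\<close> of the product.\<close>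

lemma divergence_concircular_warped:
  fixes k :: real
  assumes t: "t \<in> J" and x: "x \<in> U"
  defines "k \<equiv> (real DIM('e) + 1) * real DIM('e)"
  shows "divergence4 H (concircular H) (t, x) X Y Z = divergence4 h (riemann4 h) x (snd X) (snd Y) (snd Z)
    - (H (t, x) X Z * dirD (scalar_curvature h) x (snd Y)
       - H (t, x) Y Z * dirD (scalar_curvature h) x (snd X)) / k"
  using total.divergence_concircular[of "(t, x)" X Y Z] t x
  by (simp add: divergence_riemann_warped dirD_scalar_curvature_warped k_def add.commute)

lemma divergence_free_warped_iff:
  assumes t: "t \<in> J" and x: "x \<in> U" and n: "DIM('e) \<ge> 3"
  shows "(\<forall>X Y Z. divergence4 H (concircular H) (t, x) X Y Z = 0) \<longleftrightarrow>
         (\<forall>u v w. divergence4 h (concircular h) x u v w = 0)"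
proof
  let ?t = "dirD (scalar_curvature h) x"
  assume L: "\<forall>X Y Z. divergence4 H (concircular H) (t, x) X Y Z = 0"
  \<comment> \<open>Prepares the evaluation with \<open>(1, 0)\<close> as third argument: its
    spatial part is 0, so the curvature contributes nothing and only the scalar curvature term
    survives.\<close>
  have "divergence4 h (riemann4 h) x u v 0 = 0" for u v
    unfolding divergence4_def
    by (simp add: linear_0[OF linear_nabla4(4)[OF smooth_tensor4_riemann x]])
  then have \<tau>: "?t v = 0" for v
    using L[rule_format, of "(1, 0)" "(0, v)" "(1, 0)"] F_pos[OF x] n
    by (simp add: divergence_concircular_warped[OF t x] warped_metric_apply linear_0[OF linear_left[OF x]]
        linear_0[OF linear_right[OF x]])
  then have "divergence4 h (riemann4 h) x u v w = 0" for u v w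
    using L[rule_format, of "(0, u)" "(0, v)" "(0, w)"] by (simp add: divergence_concircular_warped[OF t x])
  then show "\<forall>u v w. divergence4 h (concircular h) x u v w = 0"
    by (simp add: divergence_concircular[OF x] \<tau>)
next
  let ?t = "dirD (scalar_curvature h) x"
  assume Rt: "\<forall>u v w. divergence4 h (concircular h) x u v w = 0"
  then have \<tau>: "?t v = 0" for v using scalar_curvature_stationary[OF x n] by blast
  then have "divergence4 h (riemann4 h) x u v w = 0" for u v w
    using Rt divergence_concircular[OF x, of u v w] by simp
  then show "\<forall>X Y Z. divergence4 H (concircular H) (t, x) X Y Z = 0"
    by (simp add: divergence_concircular_warped[OF t x] \<tau>)
qed

end

section \<open>From charts to the manifold\<close>

lemma static_metric_eq_warped: "static_metric M g f k = warped_metric (g k) (f \<circ> cinv M k)"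
  by (simp add: static_metric_def warped_metric_def)

lemma coordinate_metric_chart:
  assumes "pseudo_riemannian_manifold M g" "k \<in> charts M"
  shows "coordinate_metric (cimage M k) (g k)"
proof
  show "open (cimage M k)"
    using assms by (simp add: pseudo_riemannian_manifold_def smooth_manifold_def)
qed (use assms in \<open>auto simp: pseudo_riemannian_manifold_def pseudo_riemannian_metric_def\<close>)

theorem corollary5:
  fixes M :: "('a, 'k, 'e::euclidean_space) atlas"
    and g :: "'k \<Rightarrow> 'e local_metric"
    and I :: "real set"
    and f :: "'a \<Rightarrow> real"
  assumes "pseudo_riemannian_manifold M g"
    and "DIM('e) \<ge> 3"
    and "open I" "is_interval I" "I \<noteq> {}"
    and "smooth_function M f"
    and "\<forall>p\<in>topspace (base M). f p > 0"
    and "hessian_zero M g f"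
  shows "concircular_divergence_free (interval_times I M) (static_metric M g f) \<longleftrightarrow>
         concircular_divergence_free M g"
proof -
  let ?N = "interval_times I M" and ?H = "static_metric M g f"
  have N: "pseudo_riemannian_manifold ?N ?H"
    by (rule pseudo_riemannian_static) (use assms in auto)
  have ch: "charts ?N = charts M" by (simp add: interval_times_def)
  have pointwise: "(\<forall>X Y Z. divergence4 (?H k) (concircular (?H k)) (t, x) X Y Z = 0) \<longleftrightarrow>
      (\<forall>u v w. divergence4 (g k) (concircular (g k)) x u v w = 0)"
    if k: "k \<in> charts M" and t: "t \<in> I" and x: "x \<in> cimage M k" for k t x
  proof -
    have "static_chart (cimage M k) (g k) I (f \<circ> cinv M k)"
    proof (intro static_chart.intro static_chart_axioms.intro)
      show "coordinate_metric (cimage M k) (g k)"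
        by (rule coordinate_metric_chart[OF assms(1) k])
      show "coordinate_metric (I \<times> cimage M k) (warped_metric (g k) (f \<circ> cinv M k))"
        using coordinate_metric_chart[OF N, of k] k
        by (simp add: ch cimage_interval_times static_metric_eq_warped)
      show "smooth_on (cimage M k) (f \<circ> cinv M k)"
        using assms(6) k by (simp add: smooth_function_def)
      show "(f \<circ> cinv M k) x > 0" if "x \<in> cimage M k" for x
      proof -
        have "cinv M k x \<in> cdom M k"
          using that by (simp add: cinv_def cimage_def inv_into_into)
        moreover have "cdom M k \<subseteq> topspace (base M)"
          using assms(1) k openin_subset
          by (auto simp: pseudo_riemannian_manifold_def smooth_manifold_def)
        ultimately show ?thesis using assms(7) by auto
      qed
      show "hessian (g k) (f \<circ> cinv M k) x u v = 0" if "x \<in> cimage M k" for x u v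
        using assms(8) k that by (simp add: hessian_zero_def)
    qed
    then show ?thesis
      unfolding static_metric_eq_warped by (rule static_chart.divergence_free_warped_iff[OF _ t x assms(2)])
  qed
  \<comment> \<open>Since \<open>I\<close> is nonempty, some \<open>(t, x)\<close> lies over each
    chart point \<open>x\<close>; this carries the vanishing on the product back to
    \<open>M\<close>.\<close>
  show ?thesis
    unfolding concircular_divergence_free_def ch cimage_interval_times
    using pointwise assms(5) by (auto simp: Ball_def split_paired_all)
qed

end
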